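(* Let $n\ge 1$ be an integer, and assume $m\in[0,1]$ and $\frac{R\mu}{C}\ge n+1$. Let $(\rho_t,f_n(\rho_t))$ be the tangent point on the graph of $f_n$ of the line through $(m,f_n(m))$. Then one of the following three cases holds: 1. If $f_n(b)+f_n'(b)(m-b)\ge f_n(m)$, then the extremal distribution that solves $\inf_{\mathbb P\in\mathcal P}\mathbb E_{\mathbb P}[f_n(\tilde\rho)]$ is the three-point distribution supported on $\rho_1=a$, $\rho_2=m$, $\rho_3=b$ with probabilities $$p_1=\frac{d}{2(m-a)},\quad p_2=1-\frac{d}{2(m-a)}-\frac{d}{2(b-m)},\quad p_3=\frac{d}{2(b-m)}.$$ 2. If $f_n(b)+f_n'(b)(m-b)<f_n(m)$ and $d<d_0:=\frac{2(m-a)(\rho_t-m)}{\rho_t-a}$, then the extremal distribution is the three-point distribution supported on $\rho_1=a$, $\rho_2=m$, $\rho_3=\rho_t$ with probabilities $$p_1=\frac{d}{2(m-a)},\quad p_2=1-\frac{d}{2(m-a)}-\frac{d}{2(\rho_t-m)},\quad p_3=\frac{d}{2(\rho_t-m)}.$$ 3. If $f_n(b)+f_n'(b)(m-b)<f_n(m)$ and $d\ge d_0:=\frac{2(m-a)(\rho_t-m)}{\rho_t-a}$, then the extremal distribution is the two-point distribution supported on $\rho_1=a$, $\rho_2=\frac{ad+2m(a-m)}{d+2(a-m)}$ with probabilities $$p_1=\frac{d}{2(m-a)},\quad p_2=1-\frac{d}{2(m-a)}.$$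
   Context: $R,C,\mu>0$ are fixed real constants. For an integer $n\ge0$, $f_n:[0,\infty)\to\mathbb R$ is $$f_n(\rho)=R\mu\,\frac{\rho(1-\rho^n)}{1-\rho^{n+1}}-C\left(\frac{\rho}{1-\rho}-\frac{(n+1)\rho^{n+1}}{1-\rho^{n+1}}\right)\ (\rho\ne1),\qquad f_n(1)=R\mu\,\frac{n}{n+1}-C\,\frac n2 .$$ Real numbers $0\le a<b$, $m\in(a,b)$ and $d\in(0,\overline d)$ with $\overline d=\frac{2(m-a)(b-m)}{b-a}$ are given. The mean-absolute-deviation (MAD) ambiguity set is $$\mathcal P=\{\mathbb P \text{ a Borel probability measure on }[a,b]:\ \mathbb E_{\mathbb P}[\tilde\rho]=m,\ \mathbb E_{\mathbb P}[|\tilde\rho-m|]=d\}.$$ An extremal distribution is an element of $\mathcal P$ attaining the infimum. The tangent point (used only in cases 2 and 3) is the point with $\rho_t\in(m,b]$ and $f_n(\rho_t)+f_n'(\rho_t)(m-\rho_t)=f_n(m)$. *)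

theory Defs
  imports "HOL-Probability.Probability"
begin

text \<open>Only the arguments \<open>\<rho> \<ge> 0\<close> are meaningful. The value at \<open>\<rho> = 1\<close> is the continuous
  extension of the formula used elsewhere.\<close>

definition profit :: "real \<Rightarrow> real \<Rightarrow> real \<Rightarrow> nat \<Rightarrow> real \<Rightarrow> real" where
  "profit R C \<mu> n \<rho> =
     (if \<rho> = 1 then R * \<mu> * (real n / (real n + 1)) - C * (real n / 2)
      else R * \<mu> * (\<rho> * (1 - \<rho> ^ n) / (1 - \<rho> ^ (n + 1)))
           - C * (\<rho> / (1 - \<rho>) - (real n + 1) * \<rho> ^ (n + 1) / (1 - \<rho> ^ (n + 1))))"

text \<open>Borel probability measures on \<open>[a, b]\<close> are represented as Borel probability measures on the
  real line that give \<open>[a, b]\<close> full measure; both integrals below are then integrals of functions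
  that are almost surely bounded.\<close>

definition mad_set :: "real \<Rightarrow> real \<Rightarrow> real \<Rightarrow> real \<Rightarrow> real measure set" where
  "mad_set a b m d =
     {P. prob_space P \<and> sets P = sets borel \<and> measure P {a..b} = 1 \<and>
         (\<integral>\<rho>. \<rho> \<partial>P) = m \<and> (\<integral>\<rho>. \<bar>\<rho> - m\<bar> \<partial>P) = d}"

text \<open>The infimum is taken in the extended reals, so that it is the true infimum whether or not
  the expectations are bounded below.\<close>

definition extremal_distributions ::
    "(real \<Rightarrow> real) \<Rightarrow> real \<Rightarrow> real \<Rightarrow> real \<Rightarrow> real \<Rightarrow> real measure set" where
  "extremal_distributions g a b m d =
     {P \<in> mad_set a b m d.
        ereal (\<integral>\<rho>. g \<rho> \<partial>P) = (INF Q \<in> mad_set a b m d. ereal (\<integral>\<rho>. g \<rho> \<partial>Q))}"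

text \<open>The entries of the list are pairs of a support point and its probability. The definition is
  meaningful if the probabilities are nonnegative and sum to \<open>1\<close>, see the lemma below.\<close>

definition discrete_distribution :: "(real \<times> real) list \<Rightarrow> real measure" where
  "discrete_distribution xs = distr (measure_pmf (pmf_of_list xs)) borel (\<lambda>x. x)"

lemma measure_discrete_distribution:
  assumes "pmf_of_list_wf xs" and "A \<in> sets borel"
  shows "measure (discrete_distribution xs) A = (\<Sum>(x, p) \<leftarrow> xs. p * indicator A x)"
proof -
  have "measure (discrete_distribution xs) A = measure (measure_pmf (pmf_of_list xs)) A"
    using assms(2) unfolding discrete_distribution_def by (subst measure_distr) auto
  also have "\<dots> = sum_list (map snd (filter (\<lambda>z. fst z \<in> A) xs))"
    using assms(1) by (rule measure_pmf_of_list)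
  also have "\<dots> = (\<Sum>(x, p) \<leftarrow> xs. p * indicator A x)"
    by (induction xs) (auto simp: indicator_def)
  finally show ?thesis .
qed

definition is_tangent_point :: "(real \<Rightarrow> real) \<Rightarrow> real \<Rightarrow> real \<Rightarrow> real \<Rightarrow> bool" where
  "is_tangent_point g m b t \<longleftrightarrow> t \<in> {m<..b} \<and> g t + deriv g t * (m - t) = g m"

end

theory Submission
  imports Defs "HOL-Computational_Algebra.Polynomial"
begin

text \<open>
  The expectation of \<open>\<alpha> + \<beta> x + \<gamma> \<bar>x - m\<bar>\<close> is the same for all members of the ambiguity set, so a
  minorant of \<open>f\<close> of this form that touches \<open>f\<close> only at \<open>a\<close>, \<open>m\<close> and one point \<open>t > m\<close> certifies
  optimality and uniqueness of the distribution on these points. Such a minorant exists because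
  \<open>f\<close> is strictly concave up to some \<open>c > m\<close> and strictly convex beyond: left of \<open>m\<close> it is a chord,
  and right of \<open>m\<close> it is the chord to \<open>b\<close>, the tangent line through \<open>(m, f m)\<close>, or (in case 3) the
  tangent at the second support point.

  With \<open>N = n + 1\<close>, \<open>r = R \<mu> / C\<close> and \<open>s = 1 + x + \<dots> + x ^ n\<close> one has
  \<open>f / C = r - r / s - x s' / s\<close>, and \<open>f'' = C T / (x ^ N - 1) ^ 3\<close> for a polynomial \<open>T\<close> with a
  triple zero at \<open>1\<close>. For \<open>r \<ge> N\<close> only the coefficients of \<open>T\<close> at \<open>x ^ (N - 1)\<close> and
  \<open>x ^ (2 N - 1)\<close> can be negative. Writing \<open>E\<^sub>p y = x y' - p y\<close>, which multiplies the \<open>i\<close>-th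
  coefficient by \<open>i - p\<close>, the polynomial obtained from \<open>T\<close> by applying \<open>E\<^sub>p\<close> and \<open>E\<^sub>q\<close> twice each,
  with \<open>p = N - 1\<close> and \<open>q = 2 N - 1\<close>, has nonnegative coefficients. Undoing these operators one by
  one with the mean value theorem gives the signs of \<open>T\<close>, as in the proof of Descartes' rule.
\<close>

section \<open>Distributions with finite support and mean absolute deviation\<close>

lemma finite_support_integral:
  fixes g :: "real \<Rightarrow> real"
  assumes "prob_space Q" and "sets Q = sets borel" and "finite A" and "AE x in Q. x \<in> A"
    and "g \<in> borel_measurable borel"
  shows "(\<integral>x. g x \<partial>Q) = (\<Sum>s\<in>A. measure Q {s} * g s)"
proof -
  interpret prob_space Q by fact
  have [measurable]: "g \<in> borel_measurable Q"
    using assms(2,5) by (simp cong: measurable_cong_sets)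
  have [measurable]: "{s} \<in> sets Q" for s :: real
    using assms(2) by simp
  have "(\<integral>x. g x \<partial>Q) = (\<integral>x. (\<Sum>s\<in>A. indicator {s} x * g s) \<partial>Q)"
  proof (rule integral_cong_AE)
    show "AE x in Q. g x = (\<Sum>s\<in>A. indicator {s} x * g s)"
      using assms(4)
    proof eventually_elim
      case (elim x)
      then show ?case
        using assms(3) by (simp add: indicator_def if_distrib if_distribR sum.delta cong: if_cong)
    qed
  qed measurable
  also have "\<dots> = (\<Sum>s\<in>A. measure Q {s} * g s)"
    by (subst Bochner_Integration.integral_sum)
      (auto intro!: integrable_mult_left integrable_real_indicator simp: emeasure_eq_measure)
  finally show ?thesis .
qed

lemma finite_support_eqI:
  assumes "prob_space P" and "sets P = sets borel" and "AE x in P. x \<in> A"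
    and "prob_space Q" and "sets Q = sets borel" and "AE x in Q. x \<in> A"
    and "finite (A :: real set)" and "\<And>s. s \<in> A \<Longrightarrow> measure P {s} = measure Q {s}"
  shows "P = Q"
proof (rule measure_eqI)
  fix B assume B: "B \<in> sets P"
  interpret P: prob_space P by fact
  interpret Q: prob_space Q by fact
  have [simp]: "B \<in> sets borel" "B \<in> sets Q"
    using B assms(2,5) by auto
  have "measure P B = (\<integral>x. indicator B x \<partial>P)" using B by simp
  also have "\<dots> = (\<Sum>s\<in>A. measure P {s} * indicator B s)"
    by (intro finite_support_integral assms borel_measurable_indicator) simp
  also have "\<dots> = (\<Sum>s\<in>A. measure Q {s} * indicator B s)"
    using assms(8) by simp
  also have "\<dots> = (\<integral>x. indicator B x \<partial>Q)"
    by (intro finite_support_integral[symmetric] assms borel_measurable_indicator) simp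
  finally have "measure P B = measure Q B" by simp
  then show "emeasure P B = emeasure Q B"
    by (simp add: P.emeasure_eq_measure Q.emeasure_eq_measure)
qed (use assms in simp)

lemma prob_space_discrete_distribution: "prob_space (discrete_distribution xs)"
  unfolding discrete_distribution_def by (intro measure_pmf.prob_space_distr) simp

lemma sets_discrete_distribution: "sets (discrete_distribution xs) = sets borel"
  unfolding discrete_distribution_def by simp

lemma AE_discrete_distribution:
  assumes "pmf_of_list_wf xs"
  shows "AE x in discrete_distribution xs. x \<in> fst ` set xs"
proof -
  interpret prob_space "discrete_distribution xs" by (rule prob_space_discrete_distribution)
  have fin: "fst ` set xs \<in> sets borel"
    by (intro borel_closed finite_imp_closed) simp
  have "sum_list (map (\<lambda>(x, p). p * indicator (fst ` set xs) x) xs) = sum_list (map snd xs)"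
    by (intro arg_cong[of _ _ sum_list] map_cong) (force simp: indicator_def)+
  then have "prob (fst ` set xs) = 1"
    using assms measure_discrete_distribution[OF assms fin] by (simp add: pmf_of_list_wf_def)
  then show ?thesis
    using fin by (subst (asm) prob_eq_1) (auto simp: sets_discrete_distribution)
qed

text \<open>Distinctness is essential: \<open>pmf_of_list\<close> adds the weights of repeated
  points.\<close>

lemma discrete_distribution_three_point:
  assumes "distinct [x, y, z]" and "p \<ge> 0" "q \<ge> 0" "r \<ge> 0" "p + q + r = 1"
  defines "D \<equiv> discrete_distribution [(x, p), (y, q), (z, r)]"
  shows "AE w in D. w \<in> {x, y, z}"
    and "measure D {x} = p" and "measure D {y} = q" and "measure D {z} = r"
proof -
  have wf: "pmf_of_list_wf [(x, p), (y, q), (z, r)]"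
    using assms by (auto intro!: pmf_of_list_wfI)
  show "AE w in D. w \<in> {x, y, z}"
    using AE_discrete_distribution[OF wf] unfolding D_def by simp
  show "measure D {x} = p" "measure D {y} = q" "measure D {z} = r"
    using assms(1) unfolding D_def by (auto simp: measure_discrete_distribution[OF wf])
qed

text \<open>Turns a three-point distribution whose middle mass vanishes into the two-point
  distribution of case 3.\<close>

lemma discrete_distribution_drop_zero:
  assumes "p \<ge> 0" "r \<ge> 0" "p + r = 1"
  shows "discrete_distribution [(x, p), (y, 0), (z, r)] = discrete_distribution [(x, p), (z, r)]"
proof (rule measure_eqI)
  fix B assume "B \<in> sets (discrete_distribution [(x, p), (y, 0), (z, r)])"
  then have B: "B \<in> sets borel" by (simp add: sets_discrete_distribution)
  interpret P: prob_space "discrete_distribution [(x, p), (y, 0), (z, r)]"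
    by (rule prob_space_discrete_distribution)
  interpret Q: prob_space "discrete_distribution [(x, p), (z, r)]"
    by (rule prob_space_discrete_distribution)
  have "pmf_of_list_wf [(x, p), (y, 0), (z, r)]" "pmf_of_list_wf [(x, p), (z, r)]"
    using assms by (auto intro!: pmf_of_list_wfI)
  with B show "emeasure (discrete_distribution [(x, p), (y, 0), (z, r)]) B
      = emeasure (discrete_distribution [(x, p), (z, r)]) B"
    by (simp add: P.emeasure_eq_measure Q.emeasure_eq_measure measure_discrete_distribution)
qed (simp add: sets_discrete_distribution)

section \<open>The ambiguity set and the duality certificate\<close>

lemma mad_setD:
  assumes "Q \<in> mad_set a b m d"
  shows "prob_space Q" "sets Q = sets borel" "AE x in Q. x \<in> {a..b}"
    "(\<integral>x. x \<partial>Q) = m" "(\<integral>x. \<bar>x - m\<bar> \<partial>Q) = d"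
proof -
  show 1: "prob_space Q" "sets Q = sets borel" "(\<integral>x. x \<partial>Q) = m" "(\<integral>x. \<bar>x - m\<bar> \<partial>Q) = d"
    using assms by (auto simp: mad_set_def)
  interpret prob_space Q by fact
  have "prob {a..b} = 1" using assms by (simp add: mad_set_def)
  then show "AE x in Q. x \<in> {a..b}"
    by (subst (asm) prob_eq_1) (auto simp: 1)
qed

text \<open>Compactness bounds \<open>g\<close> on \<open>{a..b}\<close>, hence almost surely.
  Continuity on the whole line would be too much to ask, since the profit function can have poles at
  negative arguments.\<close>

lemma mad_set_integrable:
  assumes Q: "Q \<in> mad_set a b m d" and "continuous_on {a..b} g" and "g \<in> borel_measurable borel"
  shows "integrable Q (g :: real \<Rightarrow> real)"
proof -
  note Qp = mad_setD[OF Q]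
  interpret prob_space Q by fact
  have "bounded (g ` {a..b})"
    using assms(2) by (intro compact_imp_bounded compact_continuous_image) auto
  then obtain K where K: "\<And>x. x \<in> {a..b} \<Longrightarrow> norm (g x) \<le> K"
    unfolding bounded_iff by blast
  show ?thesis
  proof (rule integrable_const_bound)
    show "AE x in Q. norm (g x) \<le> K"
      using Qp(3) by eventually_elim (rule K)
    show "g \<in> borel_measurable Q"
      using assms(3) Qp(2) by (simp cong: measurable_cong_sets)
  qed
qed

text \<open>Total mass, mean and mean absolute deviation are three linear equations for three
  masses; each side of \<open>m\<close> must contribute \<open>d / 2\<close> to the deviation. This
  yields uniqueness once the support is known.\<close>

lemma mad_set_three_point:
  assumes Q: "Q \<in> mad_set a b m d" and "x < m" and "m < y" and "AE w in Q. w \<in> {x, m, y}"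
  shows "measure Q {x} = d / (2 * (m - x))"
    and "measure Q {m} = 1 - d / (2 * (m - x)) - d / (2 * (y - m))"
    and "measure Q {y} = d / (2 * (y - m))"
proof -
  note Qp = mad_setD[OF Q]
  interpret prob_space Q by fact
  note * = finite_support_integral[OF Qp(1,2) _ assms(4)]
  have 1: "measure Q {x} + measure Q {m} + measure Q {y} = 1"
    using *[of "\<lambda>_. 1"] assms(2,3) by (simp add: prob_space algebra_simps)
  have 2: "measure Q {x} * x + measure Q {m} * m + measure Q {y} * y = m"
    using *[of "\<lambda>w. w"] assms(2,3) Qp(4) by (simp add: algebra_simps)
  have 3: "measure Q {x} * (m - x) + measure Q {y} * (y - m) = d"
    using *[of "\<lambda>w. \<bar>w - m\<bar>"] assms(2,3) Qp(5) by (simp add: algebra_simps)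
  have "measure Q {x} * (m - x) - measure Q {y} * (y - m)
      = m * (measure Q {x} + measure Q {m} + measure Q {y})
        - (measure Q {x} * x + measure Q {m} * m + measure Q {y} * y)"
    by (simp add: algebra_simps)
  also have "\<dots> = 0" unfolding 1 2 by simp
  finally have "measure Q {x} * (m - x) = d / 2" and "measure Q {y} * (y - m) = d / 2"
    using 3 by linarith+
  then show *: "measure Q {x} = d / (2 * (m - x))" "measure Q {y} = d / (2 * (y - m))"
    using assms(2,3) by (simp_all add: field_simps)
  show "measure Q {m} = 1 - d / (2 * (m - x)) - d / (2 * (y - m))"
    using 1 unfolding * by simp
qed

text \<open>Linear programming duality: \<open>F\<close> has expectation \<open>V\<close> under
  every member, so \<open>F \<le> g\<close> makes \<open>V\<close> a lower bound, and attaining it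
  forces \<open>g = F\<close> almost surely, hence support in \<open>{a, m, t}\<close>. If
  \<open>p\<^sub>1 + p\<^sub>3 = 1\<close>, there is no mass at \<open>m\<close>, and
  \<open>F\<close> may lie strictly below \<open>g\<close> there.\<close>

lemma extremal_three_point:
  fixes g :: "real \<Rightarrow> real" and a b m d t \<alpha> \<beta> \<gamma> :: real
  defines "F \<equiv> \<lambda>x. \<alpha> + \<beta> * x + \<gamma> * \<bar>x - m\<bar>"
    and "p\<^sub>1 \<equiv> d / (2 * (m - a))" and "p\<^sub>3 \<equiv> d / (2 * (t - m))"
  assumes "a < m" and "m < t" and "t \<le> b" and "0 \<le> d" and p2: "p\<^sub>1 + p\<^sub>3 \<le> 1"
    and g: "continuous_on {a..b} g" "g \<in> borel_measurable borel"
    and le: "\<And>x. x \<in> {a..b} \<Longrightarrow> F x \<le> g x"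
    and less: "\<And>x. x \<in> {a..b} \<Longrightarrow> x \<notin> {a, m, t} \<Longrightarrow> F x < g x"
    and eq: "F a = g a" "F t = g t" "F m = g m \<or> p\<^sub>1 + p\<^sub>3 = 1"
  shows "extremal_distributions g a b m d =
    {discrete_distribution [(a, p\<^sub>1), (m, 1 - p\<^sub>1 - p\<^sub>3), (t, p\<^sub>3)]}"
proof -
  define D where "D = discrete_distribution [(a, p\<^sub>1), (m, 1 - p\<^sub>1 - p\<^sub>3), (t, p\<^sub>3)]"
  define V where "V = \<alpha> + \<beta> * m + \<gamma> * d"
  have p0: "0 \<le> p\<^sub>1" "0 \<le> p\<^sub>3"
    using assms(4-7) unfolding p\<^sub>1_def p\<^sub>3_def by auto
  have dist: "distinct [a, m, t]" using \<open>a < m\<close> \<open>m < t\<close> by auto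
  note D3 = discrete_distribution_three_point[OF dist p0(1) _ p0(2), of "1 - p\<^sub>1 - p\<^sub>3", folded D_def]
  have D: "AE w in D. w \<in> {a, m, t}" "measure D {a} = p\<^sub>1" "measure D {m} = 1 - p\<^sub>1 - p\<^sub>3"
      "measure D {t} = p\<^sub>3"
    using D3 p2 by auto
  have Dp: "prob_space D" "sets D = sets borel"
    unfolding D_def by (simp_all add: prob_space_discrete_distribution sets_discrete_distribution)
  interpret D: prob_space D by fact
  have ED: "(\<integral>x. u x \<partial>D) = p\<^sub>1 * u a + (1 - p\<^sub>1 - p\<^sub>3) * u m + p\<^sub>3 * u t"
    if "u \<in> borel_measurable borel" for u :: "real \<Rightarrow> real"
    using finite_support_integral[OF Dp _ D(1) that] D dist by simp
  have p1d: "p\<^sub>1 * (m - a) = d / 2" and p3d: "p\<^sub>3 * (t - m) = d / 2"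
    using \<open>a < m\<close> \<open>m < t\<close> unfolding p\<^sub>1_def p\<^sub>3_def by (simp_all add: field_simps)
  have D_mad: "D \<in> mad_set a b m d"
  proof -
    have "AE x in D. x \<in> {a..b}"
      using D(1) by eventually_elim (use assms(4-6) in auto)
    then have "measure D {a..b} = 1"
      by (subst D.prob_eq_1) (auto simp: Dp)
    moreover have "(\<integral>x. x \<partial>D) = m"
      using p1d p3d by (subst ED) (auto simp: algebra_simps)
    moreover have "(\<integral>x. \<bar>x - m\<bar> \<partial>D) = d"
      using p1d p3d \<open>a < m\<close> \<open>m < t\<close> by (subst ED) (auto simp: algebra_simps)
    ultimately show ?thesis using Dp by (simp add: mad_set_def)
  qed
  have F_int: "integrable Q F" and F_val: "(\<integral>x. F x \<partial>Q) = V" if Q: "Q \<in> mad_set a b m d" for Q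
  proof -
    interpret prob_space Q using mad_setD[OF Q] by simp
    have [simp]: "integrable Q (\<lambda>x. x)"
      by (rule mad_set_integrable[OF Q]) simp_all
    have [simp]: "integrable Q (\<lambda>x. \<bar>x - m\<bar>)"
      by (rule mad_set_integrable[OF Q]) (intro continuous_intros, simp)
    show "integrable Q F" unfolding F_def by simp
    show "(\<integral>x. F x \<partial>Q) = V"
      unfolding F_def V_def using mad_setD[OF Q] by (simp add: prob_space)
  qed
  have g_ge: "V \<le> (\<integral>x. g x \<partial>Q)" and g_eq: "(\<integral>x. g x \<partial>Q) = V \<Longrightarrow> Q = D"
    if Q: "Q \<in> mad_set a b m d" for Q
  proof -
    note Qp = mad_setD[OF Q]
    interpret prob_space Q by fact
    note gi = mad_set_integrable[OF Q g]
    have nn: "AE x in Q. 0 \<le> g x - F x"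
      using Qp(3) by eventually_elim (use le in auto)
    have diff: "(\<integral>x. g x - F x \<partial>Q) = (\<integral>x. g x \<partial>Q) - V"
      using gi F_int[OF Q] F_val[OF Q] by simp
    then show "V \<le> (\<integral>x. g x \<partial>Q)"
      using integral_nonneg_AE[OF nn] by simp
    assume "(\<integral>x. g x \<partial>Q) = V"
    then have "AE x in Q. g x - F x = 0"
      using integral_nonneg_eq_0_iff_AE[OF _ nn] gi F_int[OF Q] diff by simp
    then have "AE x in Q. x \<in> {a, m, t}"
      using Qp(3) by eventually_elim (use less in force)
    moreover note mad_set_three_point[OF Q \<open>a < m\<close> \<open>m < t\<close> this]
    ultimately show "Q = D"
      by (intro finite_support_eqI[OF Qp(1,2) _ Dp D(1)]) (auto simp: D p\<^sub>1_def p\<^sub>3_def)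
  qed
  have g_D: "(\<integral>x. g x \<partial>D) = V"
  proof -
    have "(\<integral>x. g x \<partial>D) = (\<integral>x. F x \<partial>D)"
      unfolding ED[OF g(2)] using eq by (subst ED) (auto simp: F_def)
    then show ?thesis using F_val[OF D_mad] by simp
  qed
  have inf: "(INF Q \<in> mad_set a b m d. ereal (\<integral>x. g x \<partial>Q)) = ereal V"
  proof (rule antisym)
    show "(INF Q \<in> mad_set a b m d. ereal (\<integral>x. g x \<partial>Q)) \<le> ereal V"
      by (rule INF_lower2[OF D_mad]) (simp add: g_D)
    show "ereal V \<le> (INF Q \<in> mad_set a b m d. ereal (\<integral>x. g x \<partial>Q))"
      by (rule INF_greatest) (simp add: g_ge)
  qed
  show ?thesis
    unfolding extremal_distributions_def inf D_def[symmetric] ereal.inject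
  proof (intro equalityI subsetI)
    fix Q assume "Q \<in> {P \<in> mad_set a b m d. (\<integral>x. g x \<partial>P) = V}"
    then show "Q \<in> {D}" using g_eq by blast
  next
    fix Q assume "Q \<in> {D}"
    then show "Q \<in> {P \<in> mad_set a b m d. (\<integral>x. g x \<partial>P) = V}" using D_mad g_D by blast
  qed
qed

section \<open>Concave-convex functions\<close>

text \<open>The derivative is only required right of \<open>a\<close>, because \<open>a = 0\<close>
  is allowed and the profit function is shown to be differentiable at positive arguments only. The
  case \<open>c = b\<close> covers an inflection point beyond \<open>b\<close>.\<close>

locale concave_convex =
  fixes f f' :: "real \<Rightarrow> real" and a m c b :: real
  assumes order: "a < m" "m < c" "c \<le> b"
    and cont: "continuous_on {a..b} f"
    and deriv: "\<And>x. a < x \<Longrightarrow> x \<le> b \<Longrightarrow> (f has_real_derivative f' x) (at x)"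
    and cont': "continuous_on {a<..b} f'"
    and dec: "\<And>x y. a < x \<Longrightarrow> x < y \<Longrightarrow> y \<le> c \<Longrightarrow> f' y < f' x"
    and inc: "\<And>x y. c \<le> x \<Longrightarrow> x < y \<Longrightarrow> y \<le> b \<Longrightarrow> f' x < f' y"
begin

lemma mvt:
  assumes "a \<le> x" "x < y" "y \<le> b"
  obtains z where "x < z" "z < y" "f y - f x = (y - x) * f' z"
proof -
  have "\<exists>l z. x < z \<and> z < y \<and> DERIV f z :> l \<and> f y - f x = (y - x) * l"
  proof (rule MVT[OF \<open>x < y\<close>])
    show "continuous_on {x..y} f" by (rule continuous_on_subset[OF cont]) (use assms in auto)
    show "f differentiable (at z)" if "x < z" "z < y" for z
      using deriv[of z] that assms unfolding real_differentiable_def by auto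
  qed
  then obtain l z where z: "x < z" "z < y" "DERIV f z :> l" "f y - f x = (y - x) * l" by blast
  have "l = f' z" by (rule DERIV_unique[OF z(3)]) (use deriv z assms in auto)
  with z that show ?thesis by auto
qed

text \<open>If \<open>f\<close> did not exceed the line at \<open>x\<close>, it would have slope at
  most \<open>k\<close> somewhere left of \<open>x\<close> and at least \<open>k\<close> somewhere
  right of \<open>x\<close>, although \<open>f'\<close> decreases strictly.\<close>

lemma above_chord:
  assumes "a \<le> u" "u < x" "x < v" "v \<le> c" and "\<alpha> + k * u \<le> f u" "\<alpha> + k * v \<le> f v"
  shows "\<alpha> + k * x < f x"
proof (rule ccontr)
  assume neg: "\<not> \<alpha> + k * x < f x"
  obtain y where y: "u < y" "y < x" "f x - f u = (x - u) * f' y"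
    by (rule mvt[of u x]) (use assms order in auto)
  obtain z where z: "x < z" "z < v" "f v - f x = (v - x) * f' z"
    by (rule mvt[of x v]) (use assms order in auto)
  have "(x - u) * f' y \<le> (x - u) * k" "(v - x) * k \<le> (v - x) * f' z"
    using neg assms y z by (auto simp: algebra_simps)
  then have "f' y \<le> f' z" using assms by simp
  moreover have "f' z < f' y" by (rule dec) (use assms y z in auto)
  ultimately show False by simp
qed

lemma above_tangent:
  assumes "x \<in> {c..b}" "t \<in> {c..b}" "x \<noteq> t"
  shows "f t + f' t * (x - t) < f x"
proof (cases "x < t")
  case True
  obtain z where z: "x < z" "z < t" "f t - f x = (t - x) * f' z"
    by (rule mvt[of x t]) (use assms order True in auto)
  have "f' z < f' t" by (rule inc) (use assms z in auto)
  then have "(t - x) * f' z < (t - x) * f' t" using True by simp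
  with z show ?thesis by (simp add: algebra_simps)
next
  case False
  then have "t < x" using assms by simp
  obtain z where z: "t < z" "z < x" "f x - f t = (x - t) * f' z"
    by (rule mvt[of t x]) (use assms order \<open>t < x\<close> in auto)
  have "f' t < f' z" by (rule inc) (use assms z in auto)
  then have "(x - t) * f' t < (x - t) * f' z" using \<open>t < x\<close> by simp
  with z show ?thesis by (simp add: algebra_simps)
qed

text \<open>Signed height above \<open>f m\<close>, at abscissa \<open>m\<close>, of the tangent to
  the graph at \<open>t\<close>. Tangent points are its zeros in \<open>{m<..b}\<close>, and its
  sign at \<open>b\<close> separates case 1 from the other two.\<close>

definition excess :: "real \<Rightarrow> real" where
  "excess t = f t + f' t * (m - t) - f m"

lemma excess_pos:
  assumes "m < t" "t \<le> c"
  shows "0 < excess t"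
proof -
  obtain z where z: "m < z" "z < t" "f t - f m = (t - m) * f' z"
    by (rule mvt[of m t]) (use assms order in auto)
  have "f' t < f' z" by (rule dec) (use assms z order in auto)
  then have "(t - m) * f' t < (t - m) * f' z" using assms by simp
  with z show ?thesis by (simp add: excess_def algebra_simps)
qed

text \<open>By convexity the tangent at \<open>t\<close> passes below the graph at \<open>s\<close>
  and is steeper than the tangent at \<open>s\<close>, so it is also the lower one at
  \<open>m\<close>.\<close>

lemma excess_strict_decreasing:
  assumes "c \<le> s" "s < t" "t \<le> b"
  shows "excess t < excess s"
proof -
  have "f t + f' t * (s - t) < f s" by (rule above_tangent) (use assms in auto)
  moreover have "f' s * (s - m) < f' t * (s - m)"
    using inc[of s t] assms order by simp
  ultimately show ?thesis by (simp add: excess_def algebra_simps)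
qed

text \<open>On the concave part \<open>excess\<close> is positive; on the convex part it is
  continuous and strictly decreasing, and it ends negative.\<close>

lemma ex1_excess_zero:
  assumes "excess b < 0"
  shows "\<exists>!t. t \<in> {m<..b} \<and> excess t = 0"
proof -
  have cb: "c < b"
    using excess_pos[of b] assms order by (cases "b \<le> c") auto
  have "continuous_on {c..b} excess"
    unfolding excess_def
    by (intro continuous_intros continuous_on_subset[OF cont] continuous_on_subset[OF cont'])
      (use order in auto)
  then obtain t where t: "c \<le> t" "t \<le> b" "excess t = 0"
    using IVT2'[of excess b 0 c] excess_pos[of c] assms cb order by force
  show ?thesis
  proof (rule ex1I[of _ t])
    show "t \<in> {m<..b} \<and> excess t = 0" using t order by auto
    fix s assume s: "s \<in> {m<..b} \<and> excess s = 0"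
    then have "c < s" using excess_pos[of s] by (cases "s \<le> c") auto
    then show "s = t"
      using excess_strict_decreasing[of s t] excess_strict_decreasing[of t s] s t
      by (cases s t rule: linorder_cases) auto
  qed
qed

text \<open>On the convex part this is the usual tangent inequality. On the concave part the line is
  a minorant at \<open>m\<close>, by the sign of \<open>excess t\<close>, and at \<open>c\<close>,
  hence strictly below \<open>f\<close> in between.\<close>

lemma above_line_tangent:
  assumes "t \<in> {c<..b}" "excess t \<le> 0" "x \<in> {m<..b}" "x \<noteq> t"
  shows "f t + f' t * (x - t) < f x"
proof (cases "x < c")
  case True
  have "(f t - f' t * t) + f' t * x < f x"
  proof (rule above_chord[of m x c])
    show "(f t - f' t * t) + f' t * m \<le> f m"
      using assms by (simp add: excess_def algebra_simps)
    show "(f t - f' t * t) + f' t * c \<le> f c"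
      using above_tangent[of c t] assms order by (simp add: algebra_simps)
  qed (use assms True order in auto)
  then show ?thesis by (simp add: algebra_simps)
qed (use above_tangent[of x t] assms in auto)

text \<open>The hypothesis makes the chord from \<open>m\<close> to \<open>b\<close> at least as
  steep as the tangent at \<open>b\<close>. Left of \<open>b\<close> it thus stays below that
  tangent, and so below \<open>f\<close> on the convex part; \<open>above_chord\<close> between
  \<open>m\<close> and \<open>c\<close> handles the rest.\<close>

lemma above_line_end:
  assumes "0 \<le> excess b" "m < x" "x < b"
  shows "f m + (f b - f m) / (b - m) * (x - m) < f x"
proof -
  define k where "k = (f b - f m) / (b - m)"
  have kb: "f m + k * (b - m) = f b"
    using order by (simp add: k_def)
  have "f' b * (b - m) \<le> k * (b - m)"
    using assms(1) kb by (simp add: excess_def algebra_simps)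
  then have k: "f' b \<le> k" using order by simp
  have *: "f m + k * (y - m) \<le> f y" "y \<noteq> b \<Longrightarrow> f m + k * (y - m) < f y" if "y \<in> {c..b}" for y
  proof -
    have "f m + k * (y - m) = f b + k * (y - b)"
      using kb by (simp add: algebra_simps)
    also have "\<dots> \<le> f b + f' b * (y - b)"
      using mult_right_mono_neg[OF k, of "y - b"] that by simp
    finally have le: "f m + k * (y - m) \<le> f b + f' b * (y - b)" .
    show less: "f m + k * (y - m) < f y" if "y \<noteq> b"
      using le above_tangent[of y b] that \<open>y \<in> {c..b}\<close> order by force
    show "f m + k * (y - m) \<le> f y"
      using less kb by (cases "y = b") auto
  qed
  show ?thesis
  proof (cases "x < c")
    case True
    have "(f m - k * m) + k * x < f x"
    proof (rule above_chord[of m x c])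
      show "(f m - k * m) + k * c \<le> f c"
        using *(1)[of c] order by (simp add: algebra_simps)
    qed (use assms True order in auto)
    then show ?thesis by (simp add: k_def[symmetric] algebra_simps)
  next
    case False
    then show ?thesis using *(2)[of x] assms by (simp add: k_def)
  qed
qed

end

text \<open>Nonnegativity of the middle mass as a bound on \<open>d\<close>. For
  \<open>t = b\<close> the bound is the given upper limit of \<open>d\<close>; for the tangent point
  it is the threshold \<open>d_0\<close> between cases 2 and 3.\<close>

lemma three_point_mass_le_iff:
  fixes a m t d :: real
  assumes "a < m" "m < t"
  shows "d / (2 * (m - a)) + d / (2 * (t - m)) \<le> 1 \<longleftrightarrow> d \<le> 2 * (m - a) * (t - m) / (t - a)"
proof -
  have "d / (2 * (m - a)) + d / (2 * (t - m)) = d * (t - a) / (2 * (m - a) * (t - m))"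
    using assms by (simp add: divide_simps) (simp add: algebra_simps)
  then show ?thesis
    using assms by (simp add: pos_divide_le_eq pos_le_divide_eq)
qed

section \<open>Optimal distributions for concave-convex functions\<close>

context concave_convex
begin

text \<open>Reduces the search for a minorant to a line right of \<open>m\<close>: on the left, the
  chord from \<open>(a, f a)\<close> to \<open>(m, v)\<close> stays below \<open>f\<close> by
  concavity. The three cases differ only in the choice of \<open>t\<close>, \<open>v\<close> and
  \<open>k\<close>.\<close>

lemma extremal_of_line:
  fixes d t v k :: real
  defines "p\<^sub>1 \<equiv> d / (2 * (m - a))" and "p\<^sub>3 \<equiv> d / (2 * (t - m))"
  assumes f: "f \<in> borel_measurable borel" and "0 \<le> d" and t: "t \<in> {m<..b}"
    and line: "v \<le> f m" "v + k * (t - m) = f t"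
      "\<And>x. x \<in> {m<..b} \<Longrightarrow> x \<noteq> t \<Longrightarrow> v + k * (x - m) < f x"
    and p: "p\<^sub>1 + p\<^sub>3 \<le> 1" "v = f m \<or> p\<^sub>1 + p\<^sub>3 = 1"
  shows "extremal_distributions f a b m d =
    {discrete_distribution [(a, p\<^sub>1), (m, 1 - p\<^sub>1 - p\<^sub>3), (t, p\<^sub>3)]}"
proof -
  define \<kappa> where "\<kappa> = (v - f a) / (m - a)"
  have \<kappa>: "\<kappa> * (m - a) = v - f a"
    using order by (simp add: \<kappa>_def)
  \<comment> \<open>The kinked function with value \<open>v\<close> at \<open>m\<close>, slope
    \<open>\<kappa>\<close> on the left and \<open>k\<close> on the right: the linear term carries
    the mean of the slopes, the absolute value half their difference.\<close>
  define F where "F = (\<lambda>x. (v - (\<kappa> + k) / 2 * m) + (\<kappa> + k) / 2 * x + (k - \<kappa>) / 2 * \<bar>x - m\<bar>)"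
  have F_right: "F x = v + k * (x - m)" if "m \<le> x" for x
    using that by (simp add: F_def field_simps)
  have F_left: "F x = f a - \<kappa> * a + \<kappa> * x" if "x \<le> m" for x
  proof -
    have "F x = v - \<kappa> * (m - x)" using that by (simp add: F_def field_simps)
    also have "\<dots> = f a - \<kappa> * a + \<kappa> * x" using \<kappa> by (simp add: algebra_simps)
    finally show ?thesis .
  qed
  have Fm: "F m = v" and Ft: "F t = f t" and Fa: "F a = f a"
    using F_right[of m] F_right[of t] F_left[of a] line(2) t order by auto
  have less: "F x < f x" if "x \<in> {a..b}" "x \<notin> {a, m, t}" for x
  proof (cases "x < m")
    case True
    have "f a - \<kappa> * a + \<kappa> * x < f x"
    proof (rule above_chord[of a x m])
      show "f a - \<kappa> * a + \<kappa> * m \<le> f m" using F_left[of m] Fm line(1) by simp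
    qed (use that True order in auto)
    then show ?thesis using F_left True by simp
  next
    case False
    then show ?thesis using line(3)[of x] F_right[of x] that by auto
  qed
  have le: "F x \<le> f x" if "x \<in> {a..b}" for x
    using less[OF that] Fm Ft Fa line(1) by (cases "x \<in> {a, m, t}") auto
  show ?thesis
    unfolding p\<^sub>1_def p\<^sub>3_def
  proof (rule extremal_three_point[where \<alpha> = "v - (\<kappa> + k) / 2 * m" and \<beta> = "(\<kappa> + k) / 2"
        and \<gamma> = "(k - \<kappa>) / 2"])
  qed (use order t cont f p assms(4) le less Fm Ft Fa
      in \<open>simp_all add: p\<^sub>1_def p\<^sub>3_def F_def\<close>)
qed

lemma extremal_end:
  assumes "f \<in> borel_measurable borel" and "0 < d" "d < 2 * (m - a) * (b - m) / (b - a)"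
    and "0 \<le> excess b"
  shows "extremal_distributions f a b m d =
    {discrete_distribution [(a, d / (2 * (m - a))),
       (m, 1 - d / (2 * (m - a)) - d / (2 * (b - m))), (b, d / (2 * (b - m)))]}"
proof (rule extremal_of_line[where v = "f m" and k = "(f b - f m) / (b - m)"])
  show "f m + (f b - f m) / (b - m) * (x - m) < f x" if "x \<in> {m<..b}" "x \<noteq> b" for x
    by (rule above_line_end) (use assms that in auto)
  show "d / (2 * (m - a)) + d / (2 * (b - m)) \<le> 1"
    using three_point_mass_le_iff[of a m b d] assms order by simp
qed (use assms order in auto)

lemma excess_nonpos:
  assumes "t \<in> {m<..b}" "excess t \<le> 0"
  shows "t \<in> {c<..b}"
  using assms excess_pos[of t] by (cases "t \<le> c") auto

lemma extremal_tangent: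
  assumes "f \<in> borel_measurable borel" and "0 < d" "d < 2 * (m - a) * (t - m) / (t - a)"
    and t: "t \<in> {m<..b}" "excess t = 0"
  shows "extremal_distributions f a b m d =
    {discrete_distribution [(a, d / (2 * (m - a))),
       (m, 1 - d / (2 * (m - a)) - d / (2 * (t - m))), (t, d / (2 * (t - m)))]}"
proof (rule extremal_of_line[where v = "f m" and k = "f' t"])
  have t': "t \<in> {c<..b}" using t by (intro excess_nonpos) auto
  have fm: "f m = f t + f' t * (m - t)" using t by (simp add: excess_def)
  then show "f m + f' t * (t - m) = f t" by (simp add: algebra_simps)
  show "f m + f' t * (x - m) < f x" if "x \<in> {m<..b}" "x \<noteq> t" for x
    using above_line_tangent[OF t' _ that] t unfolding fm by (simp add: algebra_simps)
  show "d / (2 * (m - a)) + d / (2 * (t - m)) \<le> 1"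
    using three_point_mass_le_iff[of a m t d] assms order by simp
qed (use assms order in auto)

text \<open>The point \<open>\<rho>\<close> is where the middle mass becomes zero. The bounds on
  \<open>d\<close> place it between \<open>t\<close> and \<open>b\<close>, so by monotonicity of
  \<open>excess\<close> its tangent reaches \<open>m\<close> at or below \<open>f m\<close>; a gap
  there is harmless because \<open>m\<close> carries no mass.\<close>

lemma extremal_two_point:
  fixes d t :: real
  defines "\<rho> \<equiv> (a * d + 2 * m * (a - m)) / (d + 2 * (a - m))"
  assumes f: "f \<in> borel_measurable borel" and d: "0 < d" "d < 2 * (m - a) * (b - m) / (b - a)"
    and t: "t \<in> {m<..b}" "excess t = 0" and dt: "2 * (m - a) * (t - m) / (t - a) \<le> d"
  shows "extremal_distributions f a b m d =
    {discrete_distribution [(a, d / (2 * (m - a))), (\<rho>, 1 - d / (2 * (m - a)))]}"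
proof -
  \<comment> \<open>Hence the denominator in the definition of \<open>\<rho>\<close> is negative,
    and the mass at \<open>a\<close> is below 1.\<close>
  have "2 * (m - a) * (b - m) / (b - a) < 2 * (m - a)"
    using order by (simp add: divide_less_eq)
  then have e0: "0 < 2 * (m - a) - d" using d by simp
  have \<rho>m: "\<rho> - m = d * (m - a) / (2 * (m - a) - d)"
  proof -
    have "\<rho> = (2 * m * (m - a) - a * d) / (2 * (m - a) - d)"
      unfolding \<rho>_def by (subst minus_divide_divide[symmetric]) (simp add: algebra_simps)
    then show ?thesis using e0 by (simp add: divide_simps) (simp add: algebra_simps)
  qed
  have mass: "d / (2 * (m - a)) + d / (2 * (\<rho> - m)) = 1"
    unfolding \<rho>m using e0 order d by (simp add: divide_simps)
  have t_le: "t \<le> \<rho>"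
  proof -
    have "2 * (m - a) * (t - m) \<le> d * (t - a)"
      using dt t order by (simp add: divide_le_eq)
    then have "(t - m) * (2 * (m - a) - d) \<le> d * (m - a)" by (simp add: algebra_simps)
    then have "t - m \<le> \<rho> - m" unfolding \<rho>m using e0 by (simp add: le_divide_eq)
    then show ?thesis by simp
  qed
  have \<rho>_le: "\<rho> \<le> b"
  proof -
    have "d * (b - a) \<le> 2 * (m - a) * (b - m)"
      using d order by (simp add: less_divide_eq)
    then have "d * (m - a) \<le> (b - m) * (2 * (m - a) - d)" by (simp add: algebra_simps)
    then have "\<rho> - m \<le> b - m" unfolding \<rho>m using e0 by (simp add: divide_le_eq)
    then show ?thesis by simp
  qed
  have tc: "t \<in> {c<..b}" using t by (intro excess_nonpos) auto
  have ex: "excess \<rho> \<le> 0"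
    using excess_strict_decreasing[of t \<rho>] t_le \<rho>_le tc t by (cases "t = \<rho>") auto
  have "extremal_distributions f a b m d =
    {discrete_distribution [(a, d / (2 * (m - a))),
       (m, 1 - d / (2 * (m - a)) - d / (2 * (\<rho> - m))), (\<rho>, d / (2 * (\<rho> - m)))]}"
  proof (rule extremal_of_line[where v = "f \<rho> + f' \<rho> * (m - \<rho>)" and k = "f' \<rho>"])
    show "f \<rho> + f' \<rho> * (m - \<rho>) \<le> f m" using ex by (simp add: excess_def)
    show "f \<rho> + f' \<rho> * (m - \<rho>) + f' \<rho> * (\<rho> - m) = f \<rho>" by (simp add: algebra_simps)
    show "f \<rho> + f' \<rho> * (m - \<rho>) + f' \<rho> * (x - m) < f x" if "x \<in> {m<..b}" "x \<noteq> \<rho>" for x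
      using above_line_tangent[of \<rho> x] that ex t_le \<rho>_le tc by (simp add: algebra_simps)
  qed (use f d mass t_le \<rho>_le t in auto)
  also have "1 - d / (2 * (m - a)) - d / (2 * (\<rho> - m)) = 0" using mass by simp
  also have "d / (2 * (\<rho> - m)) = 1 - d / (2 * (m - a))" using mass by simp
  also have "discrete_distribution [(a, d / (2 * (m - a))), (m, 0), (\<rho>, 1 - d / (2 * (m - a)))]
      = discrete_distribution [(a, d / (2 * (m - a))), (\<rho>, 1 - d / (2 * (m - a)))]"
    by (rule discrete_distribution_drop_zero) (use e0 d order in auto)
  finally show ?thesis .
qed

end

section \<open>Sign changes of polynomials\<close>

definition euler_op :: "nat \<Rightarrow> real poly \<Rightarrow> real poly" where
  "euler_op p y = pCons 0 (pderiv y) - smult (real p) y"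

lemma coeff_euler_op: "coeff (euler_op p y) i = (real i - real p) * coeff y i"
  by (cases i) (simp_all add: euler_op_def coeff_pderiv algebra_simps)

lemma poly_euler_op: "poly (euler_op p y) x = x * poly (pderiv y) x - p * poly y x"
  by (simp add: euler_op_def)

text \<open>The quotient \<open>y / x ^ p\<close> has derivative
  \<open>euler_op p y / x ^ (p + 1)\<close>, so signs of \<open>euler_op p y\<close> become
  monotonicity of the quotient.\<close>

lemma euler_op_mvt:
  assumes "0 < u" "u < v"
  obtains z where "u < z" "z < v"
    "poly y v / v ^ p - poly y u / u ^ p = (v - u) * (poly (euler_op p y) z / z ^ (p + 1))"
proof -
  have "((\<lambda>x. poly y x / x ^ p) has_real_derivative poly (euler_op p y) x / x ^ (p + 1)) (at x)"
    if "0 < x" for x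
  proof -
    \<comment> \<open>For \<open>p = 0\<close> the subtraction is truncated, but the factor
      \<open>real p\<close> makes both sides zero.\<close>
    have *: "x * (real p * x ^ (p - 1)) = real p * x ^ p" by (cases p) auto
    have "((\<lambda>x. poly y x / x ^ p) has_real_derivative
        (poly (pderiv y) x * x ^ p - poly y x * (real p * x ^ (p - 1))) / (x ^ p * x ^ p)) (at x)"
      using that by (auto intro!: derivative_eq_intros)
    moreover have "(poly (pderiv y) x * x ^ p - poly y x * (real p * x ^ (p - 1))) / (x ^ p * x ^ p)
        = poly (euler_op p y) x / x ^ (p + 1)"
    proof -
      have "x * (poly (pderiv y) x * x ^ p - poly y x * (real p * x ^ (p - 1)))
          = x * poly (pderiv y) x * x ^ p - poly y x * (x * (real p * x ^ (p - 1)))"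
        by (simp add: algebra_simps)
      also have "\<dots> = poly (euler_op p y) x * x ^ p"
        unfolding * by (simp add: poly_euler_op algebra_simps)
      finally have "poly (pderiv y) x * x ^ p - poly y x * (real p * x ^ (p - 1))
          = poly (euler_op p y) x * x ^ p / x"
        using that by (simp add: eq_divide_eq mult.commute)
      then show ?thesis using that by simp
    qed
    ultimately show ?thesis by simp
  qed
  then have "\<exists>z>u. z < v \<and> poly y v / v ^ p - poly y u / u ^ p
      = (v - u) * (poly (euler_op p y) z / z ^ (p + 1))"
    by (intro MVT2) (use assms in auto)
  with that show ?thesis by blast
qed

lemma euler_op_less:
  assumes "0 < u" "u < v" and "\<And>z. u < z \<Longrightarrow> z < v \<Longrightarrow> 0 < poly (euler_op p y) z"
  shows "poly y u / u ^ p < poly y v / v ^ p"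
proof -
  obtain z where z: "u < z" "z < v"
    "poly y v / v ^ p - poly y u / u ^ p = (v - u) * (poly (euler_op p y) z / z ^ (p + 1))"
    using euler_op_mvt[OF assms(1,2)] .
  have "0 < (v - u) * (poly (euler_op p y) z / z ^ (p + 1))"
    using z assms by simp
  then show ?thesis using z(3) by linarith
qed

lemma euler_op_minus: "euler_op p (- y) = - euler_op p y"
  by (rule poly_eqI) (simp add: coeff_euler_op)

lemma euler_op_pos_right:
  assumes "poly y 1 = 0" "1 < v" "\<And>z. 1 < z \<Longrightarrow> z < v \<Longrightarrow> 0 < poly (euler_op p y) z"
  shows "0 < poly y v"
  using euler_op_less[of 1 v p y] assms by (simp add: zero_less_divide_iff)

lemma euler_op_neg_left:
  assumes "poly y 1 = 0" "0 < u" "u < 1" "\<And>z. u < z \<Longrightarrow> z < 1 \<Longrightarrow> 0 < poly (euler_op p y) z"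
  shows "poly y u < 0"
  using euler_op_less[of u 1 p y] assms by (simp add: divide_less_0_iff)

text \<open>Right of 1 the signs run negative, then at most one zero, then positive. Either phase
  may be empty, so the property can be inherited before a crossing is known to occur.\<close>

definition upcrossing :: "real poly \<Rightarrow> bool" where
  "upcrossing y \<longleftrightarrow> (\<forall>u v. 1 < u \<longrightarrow> u < v \<longrightarrow> 0 \<le> poly y u \<longrightarrow> 0 < poly y v)"

text \<open>Start of the descent: \<open>y / x ^ p\<close> increases strictly. It is applied to a
  polynomial that is negative at 1, where the Rolle argument would ask for a zero.\<close>

lemma upcrossing_euler_op_pos:
  assumes "\<And>z. 0 < z \<Longrightarrow> 0 < poly (euler_op p y) z"
  shows "upcrossing y"
  unfolding upcrossing_def
proof (intro allI impI)
  fix u v :: real assume *: "1 < u" "u < v" "0 \<le> poly y u"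
  have "0 \<le> poly y u / u ^ p" using * by simp
  also have "\<dots> < poly y v / v ^ p"
    by (rule euler_op_less) (use * assms in auto)
  finally show "0 < poly y v" using * by (simp add: zero_less_divide_iff)
qed

text \<open>Since \<open>euler_op p y = x ^ (p + 1) * (y / x ^ p)'\<close>, Rolle's argument pulls a single upward
  crossing of \<open>euler_op p y\<close> back to \<open>y\<close>.\<close>

lemma upcrossing_euler_op:
  assumes "upcrossing (euler_op p y)" "poly y 1 = 0"
  shows "upcrossing y"
  unfolding upcrossing_def
proof (intro allI impI)
  fix u v :: real assume *: "1 < u" "u < v" "0 \<le> poly y u"
  obtain z where z: "1 < z" "z < u"
    "poly y u / u ^ p - poly y 1 / 1 ^ p = (u - 1) * (poly (euler_op p y) z / z ^ (p + 1))"
    by (rule euler_op_mvt[of 1 u]) (use * in auto)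
  have "0 \<le> poly y u / u ^ p" using * by simp
  with z(3) have "0 \<le> (u - 1) * (poly (euler_op p y) z / z ^ (p + 1))"
    using assms(2) by simp
  then have "0 \<le> poly (euler_op p y) z / z ^ (p + 1)"
    using *(1) by (simp only: zero_le_mult_iff) linarith
  moreover have "0 < z ^ (p + 1)" using z(1) by simp
  ultimately have "0 \<le> poly (euler_op p y) z"
    by (simp only: zero_le_divide_iff) linarith
  then have "0 < poly (euler_op p y) w" if "z < w" for w
    using assms(1) z that unfolding upcrossing_def by blast
  then have "poly y u / u ^ p < poly y v / v ^ p"
    by (intro euler_op_less) (use * z in auto)
  with \<open>0 \<le> poly y u / u ^ p\<close> have "0 < poly y v / v ^ p" by linarith
  then show "0 < poly y v" using * by (simp add: zero_less_divide_iff)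
qed

text \<open>The polynomials \<open>Y1\<close> to \<open>Y4\<close> result from applying the
  operators with parameters \<open>p\<close>, \<open>q\<close>, \<open>q\<close>, \<open>p\<close>
  in turn. Positivity of \<open>Y4\<close> is pulled back: on \<open>(0, 1)\<close> the signs of
  \<open>Y3\<close>, \<open>Y2\<close>, \<open>Y1\<close>, \<open>T\<close> alternate, just right of
  1 all are negative, and globally each has at most one upward crossing.\<close>

lemma poly_single_crossing:
  fixes T :: "real poly" and p q :: nat
  assumes nonneg: "\<And>i. i \<noteq> p \<Longrightarrow> i \<noteq> q \<Longrightarrow> 0 \<le> coeff T i" and pos: "0 < coeff T 0" "0 < p" "0 < q"
    and zero: "poly T 1 = 0" "poly (pderiv T) 1 = 0" "poly (pderiv (pderiv T)) 1 = 0"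
    and neg: "poly (pderiv (pderiv (pderiv T))) 1 < 0"
  shows "\<And>x. 0 < x \<Longrightarrow> x < 1 \<Longrightarrow> 0 < poly T x"
    and "upcrossing T"
    and "\<exists>e>1. \<forall>x. 1 < x \<longrightarrow> x < e \<longrightarrow> poly T x < 0"
proof -
  define Y1 where "Y1 = euler_op p T"
  define Y2 where "Y2 = euler_op q Y1"
  define Y3 where "Y3 = euler_op q Y2"
  define Y4 where "Y4 = euler_op p Y3"
  note Y = Y1_def Y2_def Y3_def Y4_def
  have Y1: "poly Y1 1 = 0" and Y2: "poly Y2 1 = 0"
    using zero by (simp_all add: Y euler_op_def pderiv_diff pderiv_smult pderiv_pCons)
  \<comment> \<open>Each operator lowers the order of the zero at 1 by one, and at the leading order
    it acts as differentiation.\<close>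
  have "poly Y3 1 = poly (pderiv (pderiv (pderiv T))) 1"
    using zero by (simp add: Y euler_op_def pderiv_diff pderiv_smult pderiv_pCons pderiv_add)
  with neg have Y3: "poly Y3 1 < 0" by simp
  have Y4: "0 < poly Y4 x" if "0 < x" for x
  proof -
    \<comment> \<open>Applying each operator twice gives a square, so no sign is changed, while the
      coefficients at \<open>p\<close> and \<open>q\<close> are annihilated.\<close>
    have c: "coeff Y4 i = ((real i - p) * (real i - q))\<^sup>2 * coeff T i" for i
      by (simp add: Y coeff_euler_op power2_eq_square)
    then have nn: "0 \<le> coeff Y4 i" for i
      using nonneg by (cases "i = p \<or> i = q") auto
    have c0: "0 < coeff Y4 0" using pos by (simp add: c)
    have "coeff Y4 0 * x ^ 0 \<le> (\<Sum>i\<le>degree Y4. coeff Y4 i * x ^ i)"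
      by (rule member_le_sum) (use nn that in auto)
    with c0 show ?thesis by (simp add: poly_altdef)
  qed
  have "upcrossing Y3" by (rule upcrossing_euler_op_pos[of p]) (use Y4 Y4_def in auto)
  then show "upcrossing T"
    using upcrossing_euler_op Y1 Y2 zero(1) unfolding Y by blast
  have Y3l: "poly Y3 x < 0" if "0 < x" "x < 1" for x
  proof -
    have "poly Y3 x / x ^ p < poly Y3 1 / 1 ^ p"
      by (rule euler_op_less) (use Y4 Y4_def that in auto)
    with Y3 have "poly Y3 x / x ^ p < 0" by simp
    with that show ?thesis by (simp add: divide_less_0_iff)
  qed
  have Y2l: "0 < poly Y2 x" if "0 < x" "x < 1" for x
    using euler_op_neg_left[of "- Y2" x q] Y3l that Y2 by (auto simp: euler_op_minus Y3_def)
  have Y1l: "poly Y1 x < 0" if "0 < x" "x < 1" for x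
    using euler_op_neg_left[of Y1 x q] Y2l that Y1 by (auto simp: Y2_def)
  show "0 < poly T x" if "0 < x" "x < 1" for x
    using euler_op_neg_left[of "- T" x p] Y1l that zero by (auto simp: euler_op_minus Y1_def)
  have "\<forall>\<^sub>F x in at_right 1. poly Y3 x < 0"
    by (rule order_tendstoD(2)[OF _ Y3]) (intro tendsto_intros)
  then obtain e where e: "1 < e" "\<And>x. 1 < x \<Longrightarrow> x < e \<Longrightarrow> poly Y3 x < 0"
    unfolding eventually_at_right_field by blast
  have Y2r: "poly Y2 x < 0" if "1 < x" "x < e" for x
    using euler_op_pos_right[of "- Y2" x q] e that Y2 by (auto simp: euler_op_minus Y3_def)
  have Y1r: "poly Y1 x < 0" if "1 < x" "x < e" for x
    using euler_op_pos_right[of "- Y1" x q] Y2r that Y1 by (auto simp: euler_op_minus Y2_def)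
  have "poly T x < 0" if "1 < x" "x < e" for x
    using euler_op_pos_right[of "- T" x p] Y1r that zero by (auto simp: euler_op_minus Y1_def)
  with e show "\<exists>e>1. \<forall>x. 1 < x \<longrightarrow> x < e \<longrightarrow> poly T x < 0" by blast
qed

text \<open>A zero need not exist, so positivity is only claimed below a bound \<open>b\<close>. If
  \<open>T\<close> has no nonnegative value between 1 and \<open>b\<close>, then
  \<open>c = b\<close> serves (or \<open>c = e\<close> when \<open>b \<le> 1\<close>); otherwise
  \<open>c\<close> is a zero.\<close>

lemma poly_sign_change:
  assumes "upcrossing T" and "\<exists>e>1. \<forall>x. 1 < x \<longrightarrow> x < e \<longrightarrow> poly T x < 0"
  obtains c where "1 < c" "\<And>x. 1 < x \<Longrightarrow> x < c \<Longrightarrow> poly T x < 0"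
    "\<And>x. c < x \<Longrightarrow> x < b \<Longrightarrow> 0 < poly T x"
proof -
  obtain e where e: "1 < e" "\<And>x. 1 < x \<Longrightarrow> x < e \<Longrightarrow> poly T x < 0"
    using assms(2) by blast
  show ?thesis
  proof (cases "\<exists>w. 1 < w \<and> w < b \<and> 0 \<le> poly T w")
    case False
    show ?thesis
    proof (cases "1 < b")
      case True
      then show ?thesis using that[of b] False by (auto simp: not_le)
    qed (use that[of e] e in auto)
  next
    case True
    then obtain w where w: "1 < w" "w < b" "0 \<le> poly T w" by blast
    define l where "l = (1 + min e w) / 2"
    have l: "1 < l" "l < e" "l < w" using e w by (auto simp: l_def)
    obtain c where c: "l \<le> c" "c \<le> w" "poly T c = 0"
      using IVT[of "poly T" l 0 w] e(2)[of l] l w by (auto intro: poly_isCont)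
    show ?thesis
    proof (rule that[of c])
      show "poly T x < 0" if "1 < x" "x < c" for x
        using assms(1) that c unfolding upcrossing_def by (metis less_irrefl not_le)
      show "0 < poly T x" if "c < x" "x < b" for x
        using assms(1)[unfolded upcrossing_def, rule_format, of c x] that c l by simp
    qed (use l c in auto)
  qed
qed

section \<open>Curvature of the profit function\<close>

definition geom_poly :: "nat \<Rightarrow> real poly" where
  "geom_poly n = (\<Sum>i\<le>n. monom 1 i)"

lemma geom_poly_mult: "(x - 1) * poly (geom_poly n) x = x ^ (n + 1) - 1"
  by (induction n) (simp_all add: geom_poly_def poly_monom algebra_simps)

lemma coeff_geom_poly_nonneg: "0 \<le> coeff (geom_poly n) i"
  by (simp add: geom_poly_def coeff_sum sum_nonneg)

lemma coeff_geom_poly_0: "coeff (geom_poly n) 0 = 1"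
  by (simp add: geom_poly_def coeff_sum)

lemma geom_poly_pos: "0 \<le> x \<Longrightarrow> 0 < poly (geom_poly n) x"
proof -
  assume "0 \<le> x"
  then have "x ^ 0 \<le> (\<Sum>i\<le>n. x ^ i)" by (intro member_le_sum) auto
  then show ?thesis by (simp add: geom_poly_def poly_sum poly_monom)
qed

lemma geom_poly_nonzero: "0 \<le> x \<Longrightarrow> poly (geom_poly n) x \<noteq> 0"
  using geom_poly_pos[of x n] by simp

text \<open>The falling factorials are formed in the reals, so for small \<open>i\<close> a factor
  vanishes and the formulas persist.\<close>

lemma monom_derivs_at_1:
  fixes c :: real
  shows "poly (monom c i) 1 = c"
    "poly (pderiv (monom c i)) 1 = c * real i"
    "poly (pderiv (pderiv (monom c i))) 1 = c * (real i * (real i - 1))"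
    "poly (pderiv (pderiv (pderiv (monom c i)))) 1 = c * (real i * (real i - 1) * (real i - 2))"
proof -
  consider "i = 0" | "i = 1" | j where "i = Suc (Suc j)"
    by (metis One_nat_def not0_implies_Suc)
  then show "poly (monom c i) 1 = c"
    "poly (pderiv (monom c i)) 1 = c * real i"
    "poly (pderiv (pderiv (monom c i))) 1 = c * (real i * (real i - 1))"
    "poly (pderiv (pderiv (pderiv (monom c i)))) 1 = c * (real i * (real i - 1) * (real i - 2))"
    by cases (auto simp: pderiv_monom poly_monom)
qed

lemma geom_poly_derivs_at_1:
  "poly (geom_poly n) 1 = real n + 1"
  "poly (pderiv (geom_poly n)) 1 = (real n + 1) * n / 2"
  "poly (pderiv (pderiv (geom_poly n))) 1 = (real n + 1) * n * (real n - 1) / 3"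
  "poly (pderiv (pderiv (pderiv (geom_poly n)))) 1
    = (real n + 1) * n * (real n - 1) * (real n - 2) / 4"
proof -
  have 0: "geom_poly 0 = 1" by (simp add: geom_poly_def monom_0 one_pCons)
  have Suc: "geom_poly (Suc n) = geom_poly n + monom 1 (Suc n)" for n
    by (simp add: geom_poly_def)
  note simps = 0 Suc pderiv_add monom_derivs_at_1
  show "poly (geom_poly n) 1 = real n + 1"
    by (induction n) (simp_all add: simps)
  show "poly (pderiv (geom_poly n)) 1 = (real n + 1) * n / 2"
    by (induction n) (simp_all add: simps field_simps)
  show "poly (pderiv (pderiv (geom_poly n))) 1 = (real n + 1) * n * (real n - 1) / 3"
    by (induction n) (simp_all add: simps field_simps)
  show "poly (pderiv (pderiv (pderiv (geom_poly n)))) 1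
      = (real n + 1) * n * (real n - 1) * (real n - 2) / 4"
    by (induction n) (simp_all add: simps field_simps)
qed

text \<open>The numerator of the second derivative, see \<open>profit_second_derivative\<close>.\<close>

definition curvature_poly :: "real \<Rightarrow> nat \<Rightarrow> real poly" where
  "curvature_poly r k = (let N = real k + 2 in
     smult 2 (geom_poly (k + 1) * geom_poly (k + 1) * geom_poly (k + 1))
     - monom (r * N * (N - 1)) (2 * k + 3) + monom (N * (N + 1) * (r - N)) (2 * k + 2)
     - monom (r * N * (N + 1)) (k + 1) + monom (N * (N - 1) * (r - N)) k)"

text \<open>The triple zero matches that of \<open>(x ^ N - 1) ^ 3\<close>. Here
  \<open>N = k + 2\<close> and \<open>n = k + 1\<close>, a shift that avoids truncated exponents
  such as \<open>N - 2\<close>.\<close>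

lemma curvature_poly_at_1:
  "poly (curvature_poly r k) 1 = 0"
  "poly (pderiv (curvature_poly r k)) 1 = 0"
  "poly (pderiv (pderiv (curvature_poly r k))) 1 = 0"
  "poly (pderiv (pderiv (pderiv (curvature_poly r k)))) 1
    = - ((real k + 2)\<^sup>2 * ((real k + 2)\<^sup>2 - 1) * (r - (real k + 2) / 2))"
  unfolding curvature_poly_def Let_def pderiv_add pderiv_diff pderiv_smult pderiv_mult poly_add
    poly_diff poly_smult poly_mult geom_poly_derivs_at_1 monom_derivs_at_1
  by (simp_all add: field_simps power2_eq_square)

text \<open>The assumption says \<open>r \<ge> N\<close>, so the monomials with factor
  \<open>r - N\<close> do not contribute negatively; the two subtracted monomials sit exactly at the
  excluded indices. The cube of \<open>geom_poly\<close> contributes 2 to the constant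
  coefficient.\<close>

lemma coeff_curvature_poly:
  assumes "real k + 2 \<le> r"
  shows "i \<noteq> k + 1 \<Longrightarrow> i \<noteq> 2 * k + 3 \<Longrightarrow> 0 \<le> coeff (curvature_poly r k) i"
    and "0 < coeff (curvature_poly r k) 0"
proof -
  let ?s = "geom_poly (k + 1)"
  have nn: "0 \<le> coeff (?s * ?s * ?s) i" for i
    by (auto simp: coeff_mult intro!: sum_nonneg mult_nonneg_nonneg coeff_geom_poly_nonneg)
  show "0 \<le> coeff (curvature_poly r k) i" if "i \<noteq> k + 1" "i \<noteq> 2 * k + 3"
    using nn[of i] assms that by (auto simp: curvature_poly_def Let_def simp del: coeff_mult_0)
  have "coeff (?s * ?s * ?s) 0 = 1" by (simp add: coeff_mult coeff_geom_poly_0)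
  then show "0 < coeff (curvature_poly r k) 0"
    using assms by (auto simp: curvature_poly_def Let_def intro!: add_pos_nonneg)
qed

lemma curvature_poly_sign:
  assumes "real k + 2 \<le> r"
  obtains c where "1 < c" "\<And>x. 0 < x \<Longrightarrow> x < 1 \<Longrightarrow> 0 < poly (curvature_poly r k) x"
    "\<And>x. 1 < x \<Longrightarrow> x < c \<Longrightarrow> poly (curvature_poly r k) x < 0"
    "\<And>x. c < x \<Longrightarrow> x < b \<Longrightarrow> 0 < poly (curvature_poly r k) x"
proof -
  have "0 < (real k + 2)\<^sup>2 * ((real k + 2)\<^sup>2 - 1) * (r - (real k + 2) / 2)"
    using assms by (intro mult_pos_pos) (auto intro!: one_less_power)
  then have neg: "poly (pderiv (pderiv (pderiv (curvature_poly r k)))) 1 < 0"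
    by (simp only: curvature_poly_at_1)
  note * = poly_single_crossing[where p = "k + 1" and q = "2 * k + 3", OF coeff_curvature_poly(1)[OF assms] coeff_curvature_poly(2)[OF assms]
      _ _ curvature_poly_at_1(1-3) neg]
  obtain c where "1 < c" "\<And>x. 1 < x \<Longrightarrow> x < c \<Longrightarrow> poly (curvature_poly r k) x < 0"
    "\<And>x. c < x \<Longrightarrow> x < b \<Longrightarrow> 0 < poly (curvature_poly r k) x"
    by (rule poly_sign_change[OF *(2,3), of b]) auto
  with that *(1) show ?thesis by auto
qed

section \<open>First and second derivative of the profit function\<close>

definition profit_deriv :: "real \<Rightarrow> real \<Rightarrow> nat \<Rightarrow> real \<Rightarrow> real" where
  "profit_deriv r C n x = (let s = poly (geom_poly n) x; s' = poly (pderiv (geom_poly n)) x;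
      s'' = poly (pderiv (pderiv (geom_poly n))) x
    in C * ((r * s' + x * s'\<^sup>2) / s\<^sup>2 - (s' + x * s'') / s))"

text \<open>Cancelling \<open>x - 1\<close> from the fractions removes the singularity at 1 and the
  case distinction in \<open>profit\<close>.\<close>

lemma profit_eq_geom_poly:
  assumes "R * \<mu> = C * r" "0 \<le> x"
  shows "profit R C \<mu> n x = C * (r - r / poly (geom_poly n) x
     - x * poly (pderiv (geom_poly n)) x / poly (geom_poly n) x)"
proof (cases "x = 1")
  case True
  have h: "real n / (real n + 1) = 1 - 1 / (real n + 1)" "(real n + 1) * n / 2 / (real n + 1) = real n / 2"
    by (simp_all add: field_simps)
  show ?thesis
    by (simp only: profit_def True geom_poly_derivs_at_1 assms(1) refl if_True mult_1 h)
      (simp add: algebra_simps)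
next
  case False
  define s where "s = poly (geom_poly n) x"
  define s' where "s' = poly (pderiv (geom_poly n)) x"
  define w where "w = x ^ n"
  define D where "D = x * w - 1"
  have s: "0 < s" using geom_poly_pos assms by (simp add: s_def)
  have D: "D = (x - 1) * s" using geom_poly_mult[of x n] by (simp add: s_def w_def D_def)
  then have "D \<noteq> 0" using s False by simp
  \<comment> \<open>Differentiating this polynomial identity expresses \<open>s'\<close> through
    \<open>s\<close> and \<open>w\<close>.\<close>
  have "[:-1, 1:] * geom_poly n = monom 1 (n + 1) - 1"
    unfolding poly_eq_poly_eq_iff[symmetric]
    by (rule ext) (use geom_poly_mult[of _ n] in \<open>simp add: poly_monom algebra_simps\<close>)
  then have "poly (pderiv ([:-1, 1:] * geom_poly n)) x = poly (pderiv (monom 1 (n + 1) - 1)) x"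
    by simp
  then have s': "(x - 1) * s' = (real n + 1) * w - s"
    by (simp add: pderiv_mult pderiv_monom poly_monom pderiv_pCons pderiv_diff s_def s'_def w_def
        algebra_simps)
  have h1: "x * (1 - w) / (1 - x * w) = 1 - 1 / s"
  proof -
    have "1 - 1 / s = 1 - (x - 1) / D" using False by (simp add: D)
    also have "\<dots> = (D - (x - 1)) / D" using \<open>D \<noteq> 0\<close> by (simp add: diff_divide_distrib)
    also have "\<dots> = x * (1 - w) / (1 - x * w)"
      by (subst minus_divide_divide[symmetric]) (simp add: D_def algebra_simps)
    finally show ?thesis by simp
  qed
  have h2: "x / (1 - x) - (real n + 1) * (x * w) / (1 - x * w) = x * s' / s"
  proof -
    have "x * s' / s = x * ((x - 1) * s') / D" using False by (simp add: D)
    also have "\<dots> = x * ((real n + 1) * w) / D - x * s / D"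
      unfolding s' by (simp add: algebra_simps diff_divide_distrib)
    also have "x * s / D = x / (x - 1)" using s by (simp add: D)
    also have "x / (x - 1) = - (x / (1 - x))"
      by (metis minus_diff_eq minus_divide_right)
    also have "x * ((real n + 1) * w) / D = - ((real n + 1) * (x * w) / (1 - x * w))"
      by (subst minus_divide_right) (simp add: D_def mult_ac)
    finally show ?thesis by simp
  qed
  have "profit R C \<mu> n x
      = C * r * (x * (1 - w) / (1 - x * w)) - C * (x / (1 - x) - (real n + 1) * (x * w) / (1 - x * w))"
    using False assms(1) by (simp add: profit_def w_def)
  then show ?thesis
    unfolding h1 h2 by (simp add: s_def s'_def algebra_simps)
qed

lemma profit_has_derivative:
  assumes "R * \<mu> = C * r" "0 < x"
  shows "(profit R C \<mu> n has_real_derivative profit_deriv r C n x) (at x)"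
proof (rule has_field_derivative_transform_within_open)
  let ?s = "geom_poly n"
  have s: "0 < poly ?s x" using geom_poly_pos assms by simp
  show "((\<lambda>x. C * (r - r / poly ?s x - x * poly (pderiv ?s) x / poly ?s x))
      has_real_derivative profit_deriv r C n x) (at x)"
    using s by (auto intro!: derivative_eq_intros simp: profit_deriv_def Let_def)
      (simp add: field_simps power2_eq_square)
  show "C * (r - r / poly ?s y - y * poly (pderiv ?s) y / poly ?s y) = profit R C \<mu> n y"
    if "y \<in> {0<..}" for y
    using profit_eq_geom_poly[OF assms(1), of y] that by simp
qed (use assms in auto)

lemma continuous_on_profit:
  assumes "R * \<mu> = C * r"
  shows "continuous_on {0..} (profit R C \<mu> n)"
proof -
  have "continuous_on {0..} (\<lambda>x. C * (r - r / poly (geom_poly n) x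
     - x * poly (pderiv (geom_poly n)) x / poly (geom_poly n) x))"
    by (intro continuous_intros) (auto simp: geom_poly_nonzero)
  then show ?thesis
    by (rule continuous_on_cong[THEN iffD1, rotated -1]) (use profit_eq_geom_poly[OF assms] in auto)
qed

text \<open>Continuity at 1, which the closed form below does not show, later joins the intervals on
  both sides of 1.\<close>

lemma continuous_on_profit_deriv: "continuous_on {0..} (profit_deriv r C n)"
  unfolding profit_deriv_def Let_def
  by (intro continuous_intros) (auto simp: geom_poly_nonzero)

lemma power_neq_1: "0 < x \<Longrightarrow> x \<noteq> 1 \<Longrightarrow> x ^ (k + 1) \<noteq> (1 :: real)"
  using power_eq_1_iff[of x "k + 1"] by auto

text \<open>Both expressions are derivatives of the same function. This one involves only powers of
  \<open>x\<close>, \<open>D\<close> and \<open>x - 1\<close>, which makes the next differentiation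
  tractable.\<close>

lemma profit_deriv_closed_form:
  fixes x :: real and n :: nat
  assumes x: "0 < x" "x \<noteq> 1"
  defines "N \<equiv> real n + 1" and "D \<equiv> x ^ (n + 1) - 1"
  shows "profit_deriv r C n x =
    C * (N * (r * (x - 1) + N) * x ^ n / D\<^sup>2 - r / D - 1 / (x - 1)\<^sup>2)"
proof (rule DERIV_unique)
  \<comment> \<open>The parameters \<open>C * r\<close> and 1 are one choice of \<open>R\<close> and
    \<open>\<mu>\<close> with \<open>R * \<mu> = C * r\<close>.\<close>
  show "(profit (C * r) C 1 n has_real_derivative profit_deriv r C n x) (at x)"
    by (rule profit_has_derivative) (use x in auto)
  have D: "D \<noteq> 0" using power_neq_1[OF x] by (simp add: D_def)
  show "(profit (C * r) C 1 n has_real_derivative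
      C * (N * (r * (x - 1) + N) * x ^ n / D\<^sup>2 - r / D - 1 / (x - 1)\<^sup>2)) (at x)"
  proof (rule has_field_derivative_transform_within_open)
    show "((\<lambda>y. C * (r - r * (y - 1) / (y ^ (n + 1) - 1) + (1 + 1 / (y - 1)) - N - N / (y ^ (n + 1) - 1)))
      has_real_derivative C * (N * (r * (x - 1) + N) * x ^ n / D\<^sup>2 - r / D - 1 / (x - 1)\<^sup>2)) (at x)"
    proof (rule DERIV_cong)
      have P: "((\<lambda>y. y ^ (n + 1) - 1) has_real_derivative N * x ^ n) (at x)"
        by (rule DERIV_cong[OF DERIV_diff[OF DERIV_pow DERIV_const]]) (simp add: N_def)
      have L: "((\<lambda>y. y - 1) has_real_derivative 1) (at x)"
        by (auto intro!: derivative_eq_intros)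
      have D': "x ^ (n + 1) - 1 \<noteq> 0" "x - 1 \<noteq> 0" using D x by (auto simp: D_def)
      note rules = DERIV_add DERIV_diff DERIV_const DERIV_cmult[OF L]
      show "((\<lambda>y. C * (r - r * (y - 1) / (y ^ (n + 1) - 1) + (1 + 1 / (y - 1)) - N
          - N / (y ^ (n + 1) - 1))) has_real_derivative
        C * (0 - (r * 1 * (x ^ (n + 1) - 1) - r * (x - 1) * (N * x ^ n))
              / ((x ^ (n + 1) - 1) * (x ^ (n + 1) - 1))
            + (0 + (0 * (x - 1) - 1 * 1) / ((x - 1) * (x - 1))) - 0
            - (0 * (x ^ (n + 1) - 1) - N * (N * x ^ n)) / ((x ^ (n + 1) - 1) * (x ^ (n + 1) - 1)))) (at x)"
        by (intro DERIV_cmult rules DERIV_divide P L D')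
      show "C * (0 - (r * 1 * (x ^ (n + 1) - 1) - r * (x - 1) * (N * x ^ n))
              / ((x ^ (n + 1) - 1) * (x ^ (n + 1) - 1))
            + (0 + (0 * (x - 1) - 1 * 1) / ((x - 1) * (x - 1))) - 0
            - (0 * (x ^ (n + 1) - 1) - N * (N * x ^ n)) / ((x ^ (n + 1) - 1) * (x ^ (n + 1) - 1)))
          = C * (N * (r * (x - 1) + N) * x ^ n / D\<^sup>2 - r / D - 1 / (x - 1)\<^sup>2)"
        unfolding D_def[symmetric] using D D'
        by (simp add: power2_eq_square diff_divide_distrib add_divide_distrib algebra_simps)
    qed
    show "C * (r - r * (y - 1) / (y ^ (n + 1) - 1) + (1 + 1 / (y - 1)) - N - N / (y ^ (n + 1) - 1))
        = profit (C * r) C 1 n y" if "y \<in> {0<..} - {1}" for y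
    proof -
      define w where "w = y ^ n"
      have "y * w - 1 \<noteq> 0" using power_neq_1[of y n] that by (simp add: w_def)
      then have h: "y * (1 - w) / (1 - y * w) = 1 - (y - 1) / (y * w - 1)"
        "N * (y * w) / (1 - y * w) = - N - N / (y * w - 1)"
        "y / (1 - y) = - 1 - 1 / (y - 1)"
        using that by (simp_all add: divide_simps) (simp_all add: algebra_simps)
      have "profit (C * r) C 1 n y
          = C * r * (y * (1 - w) / (1 - y * w)) - C * (y / (1 - y) - N * (y * w) / (1 - y * w))"
        using that by (simp add: profit_def w_def N_def)
      also have "\<dots> = C * (r - r * (y - 1) / (y * w - 1) + (1 + 1 / (y - 1)) - N - N / (y * w - 1))"
        unfolding h by (simp add: algebra_simps)
      finally show ?thesis by (simp add: w_def)
    qed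
  qed (use x in auto)
qed

text \<open>Differentiate the closed form and use \<open>D = (x - 1) * s\<close>: the term
  \<open>2 / (x - 1) ^ 3\<close> becomes \<open>2 * s ^ 3 / D ^ 3\<close>, the cubic part of
  \<open>curvature_poly\<close>. What remains is a polynomial identity in \<open>x\<close>,
  \<open>w\<close>, \<open>r\<close> and \<open>N\<close>.\<close>

lemma profit_second_derivative:
  assumes x: "0 < x" "x \<noteq> 1"
  shows "(profit_deriv r C (k + 1) has_real_derivative
    C * (poly (curvature_poly r k) x / (x ^ (k + 2) - 1) ^ 3)) (at x)"
proof (rule has_field_derivative_transform_within_open)
  define N where "N = real k + 2"
  define w where "w = x ^ k"
  define s where "s = poly (geom_poly (k + 1)) x"
  define D where "D = x ^ (k + 2) - 1"
  have D: "D \<noteq> 0" using power_neq_1[OF x, of "k + 1"] by (simp add: D_def)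
  have Dw: "D = x\<^sup>2 * w - 1" by (simp add: D_def w_def power2_eq_square)
  have s: "D = (x - 1) * s" using geom_poly_mult[of x "k + 1"] by (simp add: s_def D_def)
  let ?G = "\<lambda>y. C * (N * (r * (y - 1) + N) * y ^ (k + 1) / (y ^ (k + 2) - 1)\<^sup>2
    - r / (y ^ (k + 2) - 1) - 1 / (y - 1)\<^sup>2)"
  \<comment> \<open>The derivative at \<open>x\<close> of the first numerator in \<open>?G\<close>,
    with \<open>x ^ (k + 1)\<close> written as \<open>x * w\<close>.\<close>
  define u where "u = N * r * (x * w) + N * (r * (x - 1) + N) * ((N - 1) * w)"
  have "(?G has_real_derivative C * (
      (u * D\<^sup>2 - N * (r * (x - 1) + N) * (x * w) * (2 * D * (N * (x * w)))) / (D\<^sup>2 * D\<^sup>2)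
      + r * (N * (x * w)) / (D * D) + 2 / (x - 1) ^ 3)) (at x)"
  proof (rule DERIV_cong)
    have P: "((\<lambda>y. y ^ (k + 2) - 1) has_real_derivative N * (x * w)) (at x)"
      by (rule DERIV_cong[OF DERIV_diff[OF DERIV_pow DERIV_const]]) (simp add: N_def w_def)
    have P2: "((\<lambda>y. (y ^ (k + 2) - 1)\<^sup>2) has_real_derivative 2 * D * (N * (x * w))) (at x)"
      by (rule DERIV_cong[OF DERIV_power[OF P]]) (simp add: D_def)
    have L2: "((\<lambda>y. (y - 1)\<^sup>2) has_real_derivative 2 * (x - 1)) (at x)"
      by (auto intro!: derivative_eq_intros)
    have Q: "((\<lambda>y. N * (r * (y - 1) + N) * y ^ (k + 1)) has_real_derivative u) (at x)"
    proof (rule DERIV_cong[OF DERIV_mult[OF _ DERIV_pow]])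
      show "((\<lambda>y. N * (r * (y - 1) + N)) has_real_derivative N * r) (at x)"
        by (auto intro!: derivative_eq_intros)
    qed (simp add: N_def w_def u_def algebra_simps)
    have D': "x ^ (k + 2) - 1 \<noteq> 0" "(x ^ (k + 2) - 1)\<^sup>2 \<noteq> 0" "(x - 1)\<^sup>2 \<noteq> 0"
      using D x by (auto simp: D_def)
    show "(?G has_real_derivative C * ((u * (x ^ (k + 2) - 1)\<^sup>2
        - N * (r * (x - 1) + N) * x ^ (k + 1) * (2 * D * (N * (x * w))))
          / ((x ^ (k + 2) - 1)\<^sup>2 * (x ^ (k + 2) - 1)\<^sup>2)
      - (0 * (x ^ (k + 2) - 1) - r * (N * (x * w))) / ((x ^ (k + 2) - 1) * (x ^ (k + 2) - 1))
      - (0 * (x - 1)\<^sup>2 - 1 * (2 * (x - 1))) / ((x - 1)\<^sup>2 * (x - 1)\<^sup>2))) (at x)"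
      by (intro DERIV_cmult DERIV_diff DERIV_divide DERIV_const Q P P2 L2 D')
    have h: "(0 * e\<^sup>2 - 1 * (2 * e)) / (e\<^sup>2 * e\<^sup>2) = - (2 / e ^ 3)" if "e \<noteq> 0" for e :: real
      using that by (simp add: power2_eq_square power3_eq_cube)
    have e3: "(0 * (x - 1)\<^sup>2 - 1 * (2 * (x - 1))) / ((x - 1)\<^sup>2 * (x - 1)\<^sup>2) = - (2 / (x - 1) ^ 3)"
      by (rule h) (use x in simp)
    show "C * ((u * (x ^ (k + 2) - 1)\<^sup>2
        - N * (r * (x - 1) + N) * x ^ (k + 1) * (2 * D * (N * (x * w))))
          / ((x ^ (k + 2) - 1)\<^sup>2 * (x ^ (k + 2) - 1)\<^sup>2)
      - (0 * (x ^ (k + 2) - 1) - r * (N * (x * w))) / ((x ^ (k + 2) - 1) * (x ^ (k + 2) - 1))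
      - (0 * (x - 1)\<^sup>2 - 1 * (2 * (x - 1))) / ((x - 1)\<^sup>2 * (x - 1)\<^sup>2))
      = C * ((u * D\<^sup>2 - N * (r * (x - 1) + N) * (x * w) * (2 * D * (N * (x * w)))) / (D\<^sup>2 * D\<^sup>2)
      + r * (N * (x * w)) / (D * D) + 2 / (x - 1) ^ 3)"
      unfolding e3 D_def[symmetric] by (simp add: w_def)
  qed
  moreover have "(u * D\<^sup>2 - N * (r * (x - 1) + N) * (x * w) * (2 * D * (N * (x * w)))) / (D\<^sup>2 * D\<^sup>2)
      + r * (N * (x * w)) / (D * D) + 2 / (x - 1) ^ 3 = poly (curvature_poly r k) x / D ^ 3"
  proof -
    have "2 / (x - 1) ^ 3 = 2 * s ^ 3 / D ^ 3"
      using s D by (simp add: power_mult_distrib)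
    moreover have "(u * D\<^sup>2 - N * (r * (x - 1) + N) * (x * w) * (2 * D * (N * (x * w)))) / (D\<^sup>2 * D\<^sup>2)
      = (u * D - N * (r * (x - 1) + N) * (x * w) * (2 * (N * (x * w)))) / D ^ 3"
      using D by (simp add: field_simps power2_eq_square power3_eq_cube)
    moreover have "r * (N * (x * w)) / (D * D) = r * (N * (x * w)) * D / D ^ 3"
      using D by (simp add: power3_eq_cube)
    moreover have "poly (curvature_poly r k) x = 2 * s ^ 3 - r * N * (N - 1) * (x ^ 3 * w\<^sup>2)
        + N * (N + 1) * (r - N) * (x\<^sup>2 * w\<^sup>2) - r * N * (N + 1) * (x * w) + N * (N - 1) * (r - N) * w"
    proof -
      have "x ^ (2 * k + 3) = x ^ 3 * w\<^sup>2" "x ^ (2 * k + 2) = x\<^sup>2 * w\<^sup>2" "x ^ (k + 1) = x * w"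
        by (simp_all only: power_add power_even_eq w_def power_one_right) simp_all
      then show ?thesis
        unfolding curvature_poly_def Let_def poly_add poly_diff poly_smult poly_mult poly_monom
          N_def[symmetric] s_def[symmetric] w_def[symmetric]
        by (simp add: power3_eq_cube)
    qed
    moreover have "(u * D - N * (r * (x - 1) + N) * (x * w) * (2 * (N * (x * w)))) + r * (N * (x * w)) * D
       = - r * N * (N - 1) * (x ^ 3 * w\<^sup>2) + N * (N + 1) * (r - N) * (x\<^sup>2 * w\<^sup>2)
        - r * N * (N + 1) * (x * w) + N * (N - 1) * (r - N) * w"
      unfolding u_def Dw by algebra
    ultimately show ?thesis
      by (simp add: add_divide_distrib[symmetric])
  qed
  ultimately show "(?G has_real_derivative C * (poly (curvature_poly r k) x / (x ^ (k + 2) - 1) ^ 3)) (at x)"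
    by (simp add: D_def)
  show "?G y = profit_deriv r C (k + 1) y" if "y \<in> {0<..} - {1}" for y
    using profit_deriv_closed_form[of y r C "k + 1"] that
    by (simp add: N_def add.commute add.left_commute)
qed (use x in auto)

text \<open>The second derivative formula is available only away from 1, so monotonicity is proved
  on each side and joined at 1 by continuity.\<close>

lemma strict_decreasing_two_intervals:
  fixes h h' :: "real \<Rightarrow> real"
  assumes cont: "continuous_on {0..} h"
    and deriv: "\<And>x. 0 < x \<Longrightarrow> x \<noteq> 1 \<Longrightarrow> (h has_real_derivative h' x) (at x)"
    and neg: "\<And>x. 0 < x \<Longrightarrow> x < c \<Longrightarrow> x \<noteq> 1 \<Longrightarrow> h' x < 0"
    and "0 < u" "u < v" "v \<le> c"
  shows "h v < h u"
proof -
  have *: "h y < h x" if "u \<le> x" "x < y" "y \<le> v" "1 \<notin> {x<..<y}" for x y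
  proof (rule DERIV_neg_imp_decreasing_open[OF \<open>x < y\<close>])
    fix z assume z: "x < z" "z < y"
    then have "0 < z" "z < c" "z \<noteq> 1" using that assms by auto
    then show "\<exists>l. DERIV h z :> l \<and> l < 0" using deriv neg by blast
  qed (rule continuous_on_subset[OF cont], use that assms in auto)
  show ?thesis
  proof (cases "1 \<in> {u<..<v}")
    case True
    then show ?thesis using *[of u 1] *[of 1 v] by auto
  qed (use * assms in auto)
qed

text \<open>Below 1 the curvature polynomial is positive and the cube negative; between 1 and
  \<open>c\<close> these signs are swapped. Both give concavity, and beyond \<open>c\<close> both
  are positive. Since \<open>m \<le> 1 < c\<close>, the mean lies in the concave part.\<close>

lemma profit_concave_convex:
  assumes "R * \<mu> = C * r" "0 < C" "real n + 1 \<le> r" "1 \<le> n" "0 \<le> a" "a < m" "m < b" "m \<le> 1"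
  shows "\<exists>c. concave_convex (profit R C \<mu> n) (profit_deriv r C n) a m c b"
proof -
  obtain k where k: "n = k + 1" using \<open>1 \<le> n\<close> by (metis le_add_diff_inverse add.commute)
  let ?T = "poly (curvature_poly r k)"
  obtain c where c: "1 < c" "\<And>x. 0 < x \<Longrightarrow> x < 1 \<Longrightarrow> 0 < ?T x" "\<And>x. 1 < x \<Longrightarrow> x < c \<Longrightarrow> ?T x < 0"
      "\<And>x. c < x \<Longrightarrow> x < b \<Longrightarrow> 0 < ?T x"
    by (rule curvature_poly_sign[of k r b]) (use assms k in auto)
  define h where "h = (\<lambda>x. C * (?T x / (x ^ (k + 2) - 1) ^ 3))"
  have deriv: "(profit_deriv r C n has_real_derivative h x) (at x)" if "0 < x" "x \<noteq> 1" for x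
    using profit_second_derivative[OF that] by (simp add: k h_def)
  have pos: "0 < (x ^ (k + 2) - 1) ^ 3" if "1 < x" for x :: real
    using one_less_power[OF that, of "k + 2"] by simp
  have neg: "h x < 0" if "0 < x" "x < c" "x \<noteq> 1" for x
  proof (cases "x < 1")
    case True
    then have "x ^ (k + 2) < 1" using power_Suc_less_one[of x "k + 1"] that by simp
    then have "(x ^ (k + 2) - 1) ^ 3 < 0" by (simp add: odd_power_less_zero)
    then show ?thesis using c(2)[of x] that True \<open>0 < C\<close>
      by (simp add: h_def mult_less_0_iff divide_less_0_iff)
  next
    case False
    then show ?thesis using c(3)[of x] pos[of x] that \<open>0 < C\<close>
      by (simp add: h_def mult_less_0_iff divide_less_0_iff)
  qed
  \<comment> \<open>The inflection point may exceed \<open>b\<close>; then the minimum is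
    \<open>b\<close> and the convexity condition is vacuous.\<close>
  show ?thesis
  proof (intro exI[of _ "min c b"] concave_convex.intro)
    show "continuous_on {a..b} (profit R C \<mu> n)"
      by (rule continuous_on_subset[OF continuous_on_profit[OF assms(1)]]) (use assms in auto)
    show "continuous_on {a<..b} (profit_deriv r C n)"
      by (rule continuous_on_subset[OF continuous_on_profit_deriv]) (use assms in auto)
    show "(profit R C \<mu> n has_real_derivative profit_deriv r C n x) (at x)" if "a < x" "x \<le> b" for x
      by (rule profit_has_derivative[OF assms(1)]) (use that assms in auto)
    show "profit_deriv r C n y < profit_deriv r C n x" if "a < x" "x < y" "y \<le> min c b" for x y
      by (rule strict_decreasing_two_intervals[OF continuous_on_profit_deriv deriv neg])
        (use that assms in auto)
    show "profit_deriv r C n x < profit_deriv r C n y" if "min c b \<le> x" "x < y" "y \<le> b" for x y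
    proof (rule DERIV_pos_imp_increasing_open[OF \<open>x < y\<close>])
      fix z assume z: "x < z" "z < y"
      then have z': "c < z" "z < b" using that by auto
      then have "0 < h z" using c(1) c(4)[of z] pos[of z] \<open>0 < C\<close> by (simp add: h_def)
      then show "\<exists>l. DERIV (profit_deriv r C n) z :> l \<and> 0 < l"
        using deriv[of z] z' c(1) by auto
    qed (rule continuous_on_subset[OF continuous_on_profit_deriv], use that assms c(1) in auto)
  qed (use assms c in auto)
qed

lemma borel_measurable_profit: "profit R C \<mu> n \<in> borel_measurable borel"
  unfolding profit_def by measurable

text \<open>Equality with a singleton expresses optimality and uniqueness at once. Existence and
  uniqueness of the tangent point are part of the conclusion in cases 2 and 3.\<close>

theorem proposition3p3:
  fixes R C \<mu> a b m d :: real and n :: nat and f :: "real \<Rightarrow> real"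
  defines "f \<equiv> profit R C \<mu> n"
  assumes "R > 0" and "C > 0" and "\<mu> > 0"
    and "0 \<le> a" and "a < b" and "m \<in> {a<..<b}"
    and "d \<in> {0<..<2 * (m - a) * (b - m) / (b - a)}"
    and "n \<ge> 1" and "m \<in> {0..1}" and "R * \<mu> / C \<ge> real n + 1"
  shows
    "(f b + deriv f b * (m - b) \<ge> f m \<longrightarrow>
        extremal_distributions f a b m d =
          {discrete_distribution
             [(a, d / (2 * (m - a))),
              (m, 1 - d / (2 * (m - a)) - d / (2 * (b - m))),
              (b, d / (2 * (b - m)))]})
   \<and> (f b + deriv f b * (m - b) < f m \<longrightarrow>
        (\<exists>!\<rho>\<^sub>t. is_tangent_point f m b \<rho>\<^sub>t)
      \<and> (\<forall>\<rho>\<^sub>t. is_tangent_point f m b \<rho>\<^sub>t \<longrightarrow>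
           (d < 2 * (m - a) * (\<rho>\<^sub>t - m) / (\<rho>\<^sub>t - a) \<longrightarrow>
              extremal_distributions f a b m d =
                {discrete_distribution
                   [(a, d / (2 * (m - a))),
                    (m, 1 - d / (2 * (m - a)) - d / (2 * (\<rho>\<^sub>t - m))),
                    (\<rho>\<^sub>t, d / (2 * (\<rho>\<^sub>t - m)))]})
         \<and> (d \<ge> 2 * (m - a) * (\<rho>\<^sub>t - m) / (\<rho>\<^sub>t - a) \<longrightarrow>
              extremal_distributions f a b m d =
                {discrete_distribution
                   [(a, d / (2 * (m - a))),
                    ((a * d + 2 * m * (a - m)) / (d + 2 * (a - m)),
                     1 - d / (2 * (m - a)))]})))"
proof -
  define r where "r = R * \<mu> / C"
  have r: "R * \<mu> = C * r" using \<open>C > 0\<close> by (simp add: r_def)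
  obtain c where "concave_convex f (profit_deriv r C n) a m c b"
    using profit_concave_convex[OF r, of n a m b] assms by (auto simp: r_def)
  then interpret concave_convex f "profit_deriv r C n" a m c b .
  \<comment> \<open>Translates the case distinction and the tangent condition into statements about
    \<open>excess\<close>.\<close>
  have deriv_f: "deriv f x = profit_deriv r C n x" if "x \<in> {m<..b}" for x
    by (rule DERIV_imp_deriv, rule deriv) (use that order in auto)
  have excess_b: "excess b = f b + deriv f b * (m - b) - f m"
    using deriv_f[of b] order by (simp add: excess_def)
  have tangent: "is_tangent_point f m b t \<longleftrightarrow> t \<in> {m<..b} \<and> excess t = 0" for t
    using deriv_f[of t] by (auto simp: is_tangent_point_def excess_def)
  have meas: "f \<in> borel_measurable borel"
    unfolding f_def by (rule borel_measurable_profit)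
  have d: "0 < d" "d < 2 * (m - a) * (b - m) / (b - a)"
    using assms by auto
  show ?thesis
  proof (intro conjI impI allI)
    assume "f b + deriv f b * (m - b) \<ge> f m"
    then have "0 \<le> excess b" by (simp add: excess_b)
    then show "extremal_distributions f a b m d = {discrete_distribution
        [(a, d / (2 * (m - a))), (m, 1 - d / (2 * (m - a)) - d / (2 * (b - m))), (b, d / (2 * (b - m)))]}"
      by (rule extremal_end[OF meas d])
  next
    assume "f b + deriv f b * (m - b) < f m"
    then have "excess b < 0" by (simp add: excess_b)
    then show "\<exists>!\<rho>\<^sub>t. is_tangent_point f m b \<rho>\<^sub>t"
      unfolding tangent by (rule ex1_excess_zero)
  next
    fix t assume "is_tangent_point f m b t" "d < 2 * (m - a) * (t - m) / (t - a)"
    then show "extremal_distributions f a b m d = {discrete_distribution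
        [(a, d / (2 * (m - a))), (m, 1 - d / (2 * (m - a)) - d / (2 * (t - m))), (t, d / (2 * (t - m)))]}"
      unfolding tangent by (intro extremal_tangent[OF meas d(1)]) auto
  next
    fix t assume "is_tangent_point f m b t" "d \<ge> 2 * (m - a) * (t - m) / (t - a)"
    then show "extremal_distributions f a b m d = {discrete_distribution
        [(a, d / (2 * (m - a))), ((a * d + 2 * m * (a - m)) / (d + 2 * (a - m)), 1 - d / (2 * (m - a)))]}"
      unfolding tangent by (intro extremal_two_point[OF meas d, of t]) auto
  qed
qed

end
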